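(* Let $\mathcal{C}$ be a group-like monoidal groupoid with invariants $B=\pi_0(\mathcal{C})$ and $A=\mathrm{Aut}_{\mathcal{C}}(I)$, such that the group $B$ is abelian and the $B$-module structure on $A$ is trivial. Then the $A$-torsor $E$ on $B\times B$ associated to $\mathcal{C}$ (the commutator of $\mathcal{C}$), with fibres $E_{x,y}=\mathrm{Isom}_{\mathcal{C}}(X_yX_x,X_xX_y)$, is endowed, by the natural partial composition laws $\stackrel{1}{+}$ and $\stackrel{2}{+}$, with a structure of a weak biextension of $B\times B$ by $A$.
   Context: A group-like monoidal groupoid ($gr$-category) is a monoidal category $\mathcal{C}$ in which all arrows are invertible and each object is invertible up to isomorphism for the tensor product; tensor products are written $XY$, the unit is $I$. $\pi_0(\mathcal{C})=B$ is the group of isomorphism classes of objects (written additively). For each object $X$, right multiplication $a\mapsto a\otimes X$ gives an isomorphism $A=\mathrm{Aut}(I)\to\mathrm{Aut}(X)$, through which $\mathrm{Aut}(X)$ is identified with $A$; left multiplication $a\mapsto X\otimes a$ then gives an automorphism $a\mapsto{}^{x}a$ of $A$ depending only on the class $x\in B$ of $X$, and this is the $B$-module structure on $A$. For each $x\in B$ choose an object $X_x$ of class $x$, and for each $x,y$ an arrow $c_{x,y}:X_xX_y\to X_{x+y}$. $E_{x,y}$ is the set of arrows $X_yX_x\to X_xX_y$, a right $A$-torsor by composition with $\mathrm{Aut}(X_yX_x)=A$. Partial laws: for $u\in E_{x,y}$ and $v\in E_{x',y}$, $u\stackrel{1}{+}v\in E_{x+x',y}$ is the composite $$X_yX_{x+x'}\to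 X_y(X_xX_{x'})\to(X_yX_x)X_{x'}\xrightarrow{u}(X_xX_y)X_{x'}\to X_x(X_yX_{x'})\xrightarrow{v}X_x(X_{x'}X_y)\to(X_xX_{x'})X_y\to X_{x+x'}X_y,$$ and for $u\in E_{x,y}$, $w\in E_{x,y'}$, $u\stackrel{2}{+}w\in E_{x,y+y'}$ is the composite $$X_{y+y'}X_x\to(X_yX_{y'})X_x\to X_y(X_{y'}X_x)\xrightarrow{w}X_y(X_xX_{y'})\to(X_yX_x)X_{y'}\xrightarrow{u}(X_xX_y)X_{y'}\to X_x(X_yX_{y'})\to X_xX_{y+y'};$$ the unlabelled inner arrows are associativity isomorphisms and the first and last arrows are induced by $c^{\pm1}$. Weak biextension: an $A$-torsor $E$ on $B\times B$ with partial laws which are morphisms of $A$-torsors $\stackrel{1}{+}:E_{x,y}\wedge E_{x',y}\to E_{x+x',y}$ and $\stackrel{2}{+}:E_{x,y}\wedge E_{x,y'}\to E_{x,y+y'}$ ($\wedge$ the contracted product over $A$), each associative, and compatible with each other: $(a\stackrel{1}{+}b)\stackrel{2}{+}(c\stackrel{1}{+}d)=(a\stackrel{2}{+}c)\stackrel{1}{+}(b\stackrel{2}{+}d)$ for $a\in E_{x,y}$, $b\in E_{x',y}$, $c\in E_{x,y'}$, $d\in E_{x',y'}$ (commutativity is not required). *)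

theory Defs
  imports "HOL-Algebra.Group"
begin

section \<open>Monoidal categories\<close>

text \<open>
  Composition \<open>g \<bullet> f\<close> is ``\<open>g\<close> after \<open>f\<close>''.  The tensor product is written \<open>\<odot>\<close> on objects
  and \<open>\<star>\<close> on arrows.  The associator goes from \<open>(X \<odot> Y) \<odot> Z\<close> to \<open>X \<odot> (Y \<odot> Z)\<close>.
\<close>

record ('o, 'm) moncat =
  Obj :: "'o set"
  Arr :: "'m set"
  Dom :: "'m \<Rightarrow> 'o"
  Cod :: "'m \<Rightarrow> 'o"
  Ident :: "'o \<Rightarrow> 'm"
  Comp :: "'m \<Rightarrow> 'm \<Rightarrow> 'm" (infixl "\<bullet>\<index>" 60)
  Tensor_obj :: "'o \<Rightarrow> 'o \<Rightarrow> 'o" (infixl "\<odot>\<index>" 70)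
  Tensor_arr :: "'m \<Rightarrow> 'm \<Rightarrow> 'm" (infixl "\<star>\<index>" 70)
  Tensor_unit :: "'o"
  Assoc :: "'o \<Rightarrow> 'o \<Rightarrow> 'o \<Rightarrow> 'm"
  LUnit :: "'o \<Rightarrow> 'm"
  RUnit :: "'o \<Rightarrow> 'm"

definition homset :: "('o, 'm, 'z) moncat_scheme \<Rightarrow> 'o \<Rightarrow> 'o \<Rightarrow> 'm set"
  where "homset C X Y = {f \<in> Arr C. Dom C f = X \<and> Cod C f = Y}"

definition inverse_arrows :: "('o, 'm, 'z) moncat_scheme \<Rightarrow> 'm \<Rightarrow> 'm \<Rightarrow> bool"
  where "inverse_arrows C f g \<longleftrightarrow>
    f \<in> Arr C \<and> g \<in> homset C (Cod C f) (Dom C f) \<and>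
    g \<bullet>\<^bsub>C\<^esub> f = Ident C (Dom C f) \<and> f \<bullet>\<^bsub>C\<^esub> g = Ident C (Cod C f)"

definition iso_arrow :: "('o, 'm, 'z) moncat_scheme \<Rightarrow> 'm \<Rightarrow> bool"
  where "iso_arrow C f \<longleftrightarrow> (\<exists>g. inverse_arrows C f g)"

definition arr_inv :: "('o, 'm, 'z) moncat_scheme \<Rightarrow> 'm \<Rightarrow> 'm"
  where "arr_inv C f = (THE g. inverse_arrows C f g)"

definition isomorphic :: "('o, 'm, 'z) moncat_scheme \<Rightarrow> 'o \<Rightarrow> 'o \<Rightarrow> bool"
  where "isomorphic C X Y \<longleftrightarrow> (\<exists>f \<in> homset C X Y. iso_arrow C f)"

locale category =
  fixes C :: "('o, 'm, 'z) moncat_scheme" (structure)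
  assumes Dom_in_Obj: "f \<in> Arr C \<Longrightarrow> Dom C f \<in> Obj C"
    and Cod_in_Obj: "f \<in> Arr C \<Longrightarrow> Cod C f \<in> Obj C"
    and Ident_hom: "X \<in> Obj C \<Longrightarrow> Ident C X \<in> homset C X X"
    and Comp_hom: "\<lbrakk>f \<in> homset C X Y; g \<in> homset C Y Z\<rbrakk> \<Longrightarrow> g \<bullet> f \<in> homset C X Z"
    and Comp_assoc:
      "\<lbrakk>f \<in> homset C W X; g \<in> homset C X Y; h \<in> homset C Y Z\<rbrakk> \<Longrightarrow> (h \<bullet> g) \<bullet> f = h \<bullet> (g \<bullet> f)"
    and Comp_Ident_right: "f \<in> homset C X Y \<Longrightarrow> f \<bullet> Ident C X = f"
    and Comp_Ident_left: "f \<in> homset C X Y \<Longrightarrow> Ident C Y \<bullet> f = f"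

locale monoidal_category = category C for C (structure) +
  assumes Tensor_unit_in_Obj: "Tensor_unit C \<in> Obj C"
    and Tensor_obj_closed: "\<lbrakk>X \<in> Obj C; Y \<in> Obj C\<rbrakk> \<Longrightarrow> X \<odot> Y \<in> Obj C"
    and Tensor_arr_hom:
      "\<lbrakk>f \<in> homset C X X'; g \<in> homset C Y Y'\<rbrakk> \<Longrightarrow> f \<star> g \<in> homset C (X \<odot> Y) (X' \<odot> Y')"
    and Tensor_Ident:
      "\<lbrakk>X \<in> Obj C; Y \<in> Obj C\<rbrakk> \<Longrightarrow> Ident C X \<star> Ident C Y = Ident C (X \<odot> Y)"
    and Tensor_Comp:
      "\<lbrakk>f \<in> homset C X X'; f' \<in> homset C X' X''; g \<in> homset C Y Y'; g' \<in> homset C Y' Y''\<rbrakk>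
        \<Longrightarrow> (f' \<bullet> f) \<star> (g' \<bullet> g) = (f' \<star> g') \<bullet> (f \<star> g)"
    and Assoc_hom:
      "\<lbrakk>X \<in> Obj C; Y \<in> Obj C; Z \<in> Obj C\<rbrakk>
        \<Longrightarrow> Assoc C X Y Z \<in> homset C ((X \<odot> Y) \<odot> Z) (X \<odot> (Y \<odot> Z))"
    and Assoc_iso:
      "\<lbrakk>X \<in> Obj C; Y \<in> Obj C; Z \<in> Obj C\<rbrakk> \<Longrightarrow> iso_arrow C (Assoc C X Y Z)"
    and Assoc_natural:
      "\<lbrakk>f \<in> homset C X X'; g \<in> homset C Y Y'; h \<in> homset C Z Z'\<rbrakk>
        \<Longrightarrow> Assoc C X' Y' Z' \<bullet> ((f \<star> g) \<star> h) = (f \<star> (g \<star> h)) \<bullet> Assoc C X Y Z"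
    and LUnit_hom: "X \<in> Obj C \<Longrightarrow> LUnit C X \<in> homset C (Tensor_unit C \<odot> X) X"
    and LUnit_iso: "X \<in> Obj C \<Longrightarrow> iso_arrow C (LUnit C X)"
    and LUnit_natural:
      "f \<in> homset C X Y \<Longrightarrow> LUnit C Y \<bullet> (Ident C (Tensor_unit C) \<star> f) = f \<bullet> LUnit C X"
    and RUnit_hom: "X \<in> Obj C \<Longrightarrow> RUnit C X \<in> homset C (X \<odot> Tensor_unit C) X"
    and RUnit_iso: "X \<in> Obj C \<Longrightarrow> iso_arrow C (RUnit C X)"
    and RUnit_natural:
      "f \<in> homset C X Y \<Longrightarrow> RUnit C Y \<bullet> (f \<star> Ident C (Tensor_unit C)) = f \<bullet> RUnit C X"
    and pentagon:
      "\<lbrakk>W \<in> Obj C; X \<in> Obj C; Y \<in> Obj C; Z \<in> Obj C\<rbrakk>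
        \<Longrightarrow> Assoc C W X (Y \<odot> Z) \<bullet> Assoc C (W \<odot> X) Y Z =
          (Ident C W \<star> Assoc C X Y Z) \<bullet> Assoc C W (X \<odot> Y) Z \<bullet> (Assoc C W X Y \<star> Ident C Z)"
    and triangle:
      "\<lbrakk>X \<in> Obj C; Y \<in> Obj C\<rbrakk>
        \<Longrightarrow> (Ident C X \<star> LUnit C Y) \<bullet> Assoc C X (Tensor_unit C) Y = RUnit C X \<star> Ident C Y"

locale gr_category = monoidal_category C for C (structure) +
  assumes all_arrows_iso: "f \<in> Arr C \<Longrightarrow> iso_arrow C f"
    and object_invertible:
      "X \<in> Obj C \<Longrightarrow> \<exists>Y \<in> Obj C. isomorphic C (X \<odot> Y) (Tensor_unit C) \<and>
        isomorphic C (Y \<odot> X) (Tensor_unit C)"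


section \<open>The invariants of a gr-category\<close>

definition iso_class :: "('o, 'm, 'z) moncat_scheme \<Rightarrow> 'o \<Rightarrow> 'o set"
  where "iso_class C X = {Y \<in> Obj C. isomorphic C X Y}"

text \<open>
  The group of isomorphism classes, in the multiplicative notation of \<^theory>\<open>HOL-Algebra.Group\<close>.
  The product of two classes is the class of the tensor product of any two representatives.
\<close>

definition pi0 :: "('o, 'm, 'z) moncat_scheme \<Rightarrow> 'o set monoid"
  where "pi0 C =
    \<lparr>carrier = iso_class C ` Obj C,
     mult = (\<lambda>x y. {Z \<in> Obj C. \<exists>U \<in> x. \<exists>V \<in> y. isomorphic C (U \<odot>\<^bsub>C\<^esub> V) Z}),
     one = iso_class C (Tensor_unit C)\<rparr>"

definition Aut_unit :: "('o, 'm, 'z) moncat_scheme \<Rightarrow> 'm monoid"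
  where "Aut_unit C =
    \<lparr>carrier = {a \<in> homset C (Tensor_unit C) (Tensor_unit C). iso_arrow C a},
     mult = Comp C,
     one = Ident C (Tensor_unit C)\<rparr>"

text \<open>
  The maps \<open>a \<mapsto> a \<otimes> X\<close> and \<open>a \<mapsto> X \<otimes> a\<close> from \<open>Aut(I)\<close> to \<open>Aut(X)\<close>; the unit constraints
  identify \<open>I \<otimes> X\<close> and \<open>X \<otimes> I\<close> with \<open>X\<close>.
\<close>

definition right_mult :: "('o, 'm, 'z) moncat_scheme \<Rightarrow> 'o \<Rightarrow> 'm \<Rightarrow> 'm"
  where "right_mult C X a =
    LUnit C X \<bullet>\<^bsub>C\<^esub> (a \<star>\<^bsub>C\<^esub> Ident C X) \<bullet>\<^bsub>C\<^esub> arr_inv C (LUnit C X)"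

definition left_mult :: "('o, 'm, 'z) moncat_scheme \<Rightarrow> 'o \<Rightarrow> 'm \<Rightarrow> 'm"
  where "left_mult C X a =
    RUnit C X \<bullet>\<^bsub>C\<^esub> (Ident C X \<star>\<^bsub>C\<^esub> a) \<bullet>\<^bsub>C\<^esub> arr_inv C (RUnit C X)"

definition obj_action :: "('o, 'm, 'z) moncat_scheme \<Rightarrow> 'o \<Rightarrow> 'm \<Rightarrow> 'm"
  where "obj_action C X a = the_inv_into (carrier (Aut_unit C)) (right_mult C X) (left_mult C X a)"

text \<open>
  \<^const>\<open>obj_action\<close> takes the same value on all members of an isomorphism class; this
  common value is the action of the class.
\<close>

definition pi0_action :: "('o, 'm, 'z) moncat_scheme \<Rightarrow> 'o set \<Rightarrow> 'm \<Rightarrow> 'm"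
  where "pi0_action C x a = the_elem ((\<lambda>X. obj_action C X a) ` x)"


section \<open>Torsors and weak biextensions\<close>

locale right_torsor = group A for A :: "('a, 'z) monoid_scheme" (structure) +
  fixes T :: "'e set" and act :: "'e \<Rightarrow> 'a \<Rightarrow> 'e"
  assumes act_closed: "\<lbrakk>t \<in> T; a \<in> carrier A\<rbrakk> \<Longrightarrow> act t a \<in> T"
    and act_one: "t \<in> T \<Longrightarrow> act t \<one> = t"
    and act_mult: "\<lbrakk>t \<in> T; a \<in> carrier A; b \<in> carrier A\<rbrakk> \<Longrightarrow> act t (a \<otimes> b) = act (act t a) b"
    and nonempty: "T \<noteq> {}"
    and simply_transitive: "\<lbrakk>s \<in> T; t \<in> T\<rbrakk> \<Longrightarrow> \<exists>!a. a \<in> carrier A \<and> act s a = t"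

definition torsor_morphism ::
    "('a, 'z) monoid_scheme \<Rightarrow> 'e set \<Rightarrow> ('e \<Rightarrow> 'a \<Rightarrow> 'e) \<Rightarrow> 'f set \<Rightarrow> ('f \<Rightarrow> 'a \<Rightarrow> 'f) \<Rightarrow> ('e \<Rightarrow> 'f) \<Rightarrow> bool"
  where "torsor_morphism A T actT S actS \<phi> \<longleftrightarrow>
    right_torsor A T actT \<and> right_torsor A S actS \<and> \<phi> \<in> T \<rightarrow> S \<and>
    (\<forall>t \<in> T. \<forall>a \<in> carrier A. \<phi> (actT t a) = actS (\<phi> t) a)"

text \<open>
  The contracted product of two torsors under an abelian group \<open>A\<close> is the quotient of \<open>E \<times> F\<close>
  by \<open>(u a, v) \<sim> (u, v a)\<close>, with \<open>A\<close> acting by \<open>[u, v] a = [u, v a]\<close>.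
\<close>

definition contracted_rel ::
    "('a, 'z) monoid_scheme \<Rightarrow> 'e set \<Rightarrow> ('e \<Rightarrow> 'a \<Rightarrow> 'e) \<Rightarrow> 'f set \<Rightarrow> ('f \<Rightarrow> 'a \<Rightarrow> 'f)
      \<Rightarrow> (('e \<times> 'f) \<times> ('e \<times> 'f)) set"
  where "contracted_rel A E actE F actF =
    {((actE u a, v), (u, actF v a)) | u v a. u \<in> E \<and> v \<in> F \<and> a \<in> carrier A}"

definition contracted_product ::
    "('a, 'z) monoid_scheme \<Rightarrow> 'e set \<Rightarrow> ('e \<Rightarrow> 'a \<Rightarrow> 'e) \<Rightarrow> 'f set \<Rightarrow> ('f \<Rightarrow> 'a \<Rightarrow> 'f)
      \<Rightarrow> ('e \<times> 'f) set set"
  where "contracted_product A E actE F actF = (E \<times> F) // contracted_rel A E actE F actF"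

definition contracted_act ::
    "('a, 'z) monoid_scheme \<Rightarrow> 'e set \<Rightarrow> ('e \<Rightarrow> 'a \<Rightarrow> 'e) \<Rightarrow> 'f set \<Rightarrow> ('f \<Rightarrow> 'a \<Rightarrow> 'f)
      \<Rightarrow> ('e \<times> 'f) set \<Rightarrow> 'a \<Rightarrow> ('e \<times> 'f) set"
  where "contracted_act A E actE F actF p a =
    (\<Union>(u, v) \<in> p. contracted_rel A E actE F actF `` {(u, actF v a)})"

text \<open>A law \<open>E \<times> F \<rightarrow> G\<close> factors through a morphism of torsors \<open>E \<and> F \<rightarrow> G\<close>.\<close>

definition induces_torsor_morphism ::
    "('a, 'z) monoid_scheme \<Rightarrow> 'e set \<Rightarrow> ('e \<Rightarrow> 'a \<Rightarrow> 'e) \<Rightarrow> 'f set \<Rightarrow> ('f \<Rightarrow> 'a \<Rightarrow> 'f)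
      \<Rightarrow> 'g set \<Rightarrow> ('g \<Rightarrow> 'a \<Rightarrow> 'g) \<Rightarrow> ('e \<Rightarrow> 'f \<Rightarrow> 'g) \<Rightarrow> bool"
  where "induces_torsor_morphism A E actE F actF G actG p \<longleftrightarrow>
    (\<exists>\<phi>. torsor_morphism A
        (contracted_product A E actE F actF) (contracted_act A E actE F actF) G actG \<phi> \<and>
      (\<forall>u \<in> E. \<forall>v \<in> F. \<phi> (contracted_rel A E actE F actF `` {(u, v)}) = p u v))"

text \<open>
  An \<open>A\<close>-torsor on \<open>B \<times> B\<close> is given by its fibres \<open>E x y\<close>.  The laws carry the indices of the
  fibres involved: \<open>add1 x x' y\<close> is the law from \<open>E x y\<close> and \<open>E x' y\<close> to \<open>E (x \<otimes> x') y\<close>, and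
  \<open>add2 x y y'\<close> is the law from \<open>E x y\<close> and \<open>E x y'\<close> to \<open>E x (y \<otimes> y')\<close>.
\<close>

locale weak_biextension =
  B: comm_group B + A: comm_group A
  for B :: "('b, 'y) monoid_scheme" (structure) and A :: "('a, 'z) monoid_scheme" +
  fixes E :: "'b \<Rightarrow> 'b \<Rightarrow> 'e set"
    and act :: "'b \<Rightarrow> 'b \<Rightarrow> 'e \<Rightarrow> 'a \<Rightarrow> 'e"
    and add1 :: "'b \<Rightarrow> 'b \<Rightarrow> 'b \<Rightarrow> 'e \<Rightarrow> 'e \<Rightarrow> 'e"
    and add2 :: "'b \<Rightarrow> 'b \<Rightarrow> 'b \<Rightarrow> 'e \<Rightarrow> 'e \<Rightarrow> 'e"
  assumes torsor:
      "\<lbrakk>x \<in> carrier B; y \<in> carrier B\<rbrakk> \<Longrightarrow> right_torsor A (E x y) (act x y)"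
    and add1_morphism:
      "\<lbrakk>x \<in> carrier B; x' \<in> carrier B; y \<in> carrier B\<rbrakk>
        \<Longrightarrow> induces_torsor_morphism A (E x y) (act x y) (E x' y) (act x' y)
              (E (x \<otimes> x') y) (act (x \<otimes> x') y) (add1 x x' y)"
    and add2_morphism:
      "\<lbrakk>x \<in> carrier B; y \<in> carrier B; y' \<in> carrier B\<rbrakk>
        \<Longrightarrow> induces_torsor_morphism A (E x y) (act x y) (E x y') (act x y')
              (E x (y \<otimes> y')) (act x (y \<otimes> y')) (add2 x y y')"
    and add1_assoc:
      "\<lbrakk>x \<in> carrier B; x' \<in> carrier B; x'' \<in> carrier B; y \<in> carrier B;
        u \<in> E x y; v \<in> E x' y; w \<in> E x'' y\<rbrakk>
        \<Longrightarrow> add1 (x \<otimes> x') x'' y (add1 x x' y u v) w = add1 x (x' \<otimes> x'') y u (add1 x' x'' y v w)"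
    and add2_assoc:
      "\<lbrakk>x \<in> carrier B; y \<in> carrier B; y' \<in> carrier B; y'' \<in> carrier B;
        u \<in> E x y; v \<in> E x y'; w \<in> E x y''\<rbrakk>
        \<Longrightarrow> add2 x (y \<otimes> y') y'' (add2 x y y' u v) w = add2 x y (y' \<otimes> y'') u (add2 x y' y'' v w)"
    and add_interchange:
      "\<lbrakk>x \<in> carrier B; x' \<in> carrier B; y \<in> carrier B; y' \<in> carrier B;
        a \<in> E x y; b \<in> E x' y; c \<in> E x y'; d \<in> E x' y'\<rbrakk>
        \<Longrightarrow> add2 (x \<otimes> x') y y' (add1 x x' y a b) (add1 x x' y' c d) =
          add1 x x' (y \<otimes> y') (add2 x y y' a c) (add2 x' y y' b d)"


section \<open>The commutator of a gr-category\<close>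

text \<open>
  \<open>X x\<close> is the chosen object of class \<open>x\<close> and \<open>c x y : X x \<odot> X y \<rightarrow> X (x y)\<close> the chosen arrow.
\<close>

definition commutator_fibre ::
    "('o, 'm, 'z) moncat_scheme \<Rightarrow> ('o set \<Rightarrow> 'o) \<Rightarrow> 'o set \<Rightarrow> 'o set \<Rightarrow> 'm set"
  where "commutator_fibre C X x y =
    {f \<in> homset C (X y \<odot>\<^bsub>C\<^esub> X x) (X x \<odot>\<^bsub>C\<^esub> X y). iso_arrow C f}"

definition commutator_act ::
    "('o, 'm, 'z) moncat_scheme \<Rightarrow> ('o set \<Rightarrow> 'o) \<Rightarrow> 'o set \<Rightarrow> 'o set \<Rightarrow> 'm \<Rightarrow> 'm \<Rightarrow> 'm"
  where "commutator_act C X x y u a = u \<bullet>\<^bsub>C\<^esub> right_mult C (X y \<odot>\<^bsub>C\<^esub> X x) a"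

definition commutator_add1 ::
    "('o, 'm, 'z) moncat_scheme \<Rightarrow> ('o set \<Rightarrow> 'o) \<Rightarrow> ('o set \<Rightarrow> 'o set \<Rightarrow> 'm)
      \<Rightarrow> 'o set \<Rightarrow> 'o set \<Rightarrow> 'o set \<Rightarrow> 'm \<Rightarrow> 'm \<Rightarrow> 'm"
  where "commutator_add1 C X c x x' y u v =
      (c x x' \<star>\<^bsub>C\<^esub> Ident C (X y))
    \<bullet>\<^bsub>C\<^esub> arr_inv C (Assoc C (X x) (X x') (X y))
    \<bullet>\<^bsub>C\<^esub> (Ident C (X x) \<star>\<^bsub>C\<^esub> v)
    \<bullet>\<^bsub>C\<^esub> Assoc C (X x) (X y) (X x')
    \<bullet>\<^bsub>C\<^esub> (u \<star>\<^bsub>C\<^esub> Ident C (X x'))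
    \<bullet>\<^bsub>C\<^esub> arr_inv C (Assoc C (X y) (X x) (X x'))
    \<bullet>\<^bsub>C\<^esub> (Ident C (X y) \<star>\<^bsub>C\<^esub> arr_inv C (c x x'))"

definition commutator_add2 ::
    "('o, 'm, 'z) moncat_scheme \<Rightarrow> ('o set \<Rightarrow> 'o) \<Rightarrow> ('o set \<Rightarrow> 'o set \<Rightarrow> 'm)
      \<Rightarrow> 'o set \<Rightarrow> 'o set \<Rightarrow> 'o set \<Rightarrow> 'm \<Rightarrow> 'm \<Rightarrow> 'm"
  where "commutator_add2 C X c x y y' u w =
      (Ident C (X x) \<star>\<^bsub>C\<^esub> c y y')
    \<bullet>\<^bsub>C\<^esub> Assoc C (X x) (X y) (X y')
    \<bullet>\<^bsub>C\<^esub> (u \<star>\<^bsub>C\<^esub> Ident C (X y'))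
    \<bullet>\<^bsub>C\<^esub> arr_inv C (Assoc C (X y) (X x) (X y'))
    \<bullet>\<^bsub>C\<^esub> (Ident C (X y) \<star>\<^bsub>C\<^esub> w)
    \<bullet>\<^bsub>C\<^esub> Assoc C (X y) (X y') (X x)
    \<bullet>\<^bsub>C\<^esub> (arr_inv C (c y y') \<star>\<^bsub>C\<^esub> Ident C (X x))"

end

theory Submission
  imports Defs
begin

text \<open>
  The fibre over \<open>(x, y)\<close> consists of swaps \<open>u : QP \<rightarrow> PQ\<close>.  Such a swap acts on right-bracketed
  words by \<open>Q(PZ) \<rightarrow> P(QZ)\<close>, naturally in \<open>Z\<close>, and the action determines it.  On words with a
  tail, both partial laws (with \<open>c\<close> left out) become plain composites of whiskered actions, so
  associativity of \<open>+\<^sub>1\<close> and the interchange law are visible there: all associators that remain are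
  pushed to the outside by naturality and the pentagon.  The law \<open>+\<^sub>2\<close> is \<open>+\<^sub>1\<close> of the opposite
  category.  The arrows \<open>c\<close> enter by transport of structure \<open>u \<mapsto> (h \<otimes> Q) u (Q \<otimes> h)\<^sup>-\<^sup>1\<close>; two parallel
  \<open>h\<close> differ by a scalar \<open>a \<in> Aut(I)\<close>, and since the module structure is trivial the scalars
  \<open>a \<otimes> Q\<close> and \<open>Q \<otimes> a\<close> cancel.
\<close>

section \<open>Calculus of arrows\<close>

text \<open>The obstacle is the bracketing: written out, each side of an axiom is a long composite
  with associators between the swaps. Such equations are left to the simplifier, with composites
  nested to the right. Hence many rules have a variant ending in \<open>_Comp\<close>, which allows
  a further arrow \<open>k\<close> behind the pattern, and the pentagon occurs solved for several of
  its edges. A tail can be stripped off again because tensoring with an invertible object is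
  faithful. The trivial module structure is used through one consequence: a scalar whiskered by an
  object on the left is again the same scalar. This gives compatibility with the action in the
  second argument of each law, and it makes transports along parallel arrows agree, on which
  associativity rests. Commutativity of \<open>pi0 C\<close> gives \<open>c x y\<close> and
  \<open>c y x\<close> a common target, so that the fibres are inhabited. Commutativity of
  \<open>Aut_unit C\<close>, on which the contracted product rests, follows from naturality of
  scalars.\<close>

context category
begin

lemma Dom_Cod_Obj [simp]:
  assumes "f \<in> Arr C"
  shows "Dom C f \<in> Obj C" "Cod C f \<in> Obj C"
  using assms Dom_in_Obj Cod_in_Obj by auto

lemma Ident_simps [simp]:
  assumes "X \<in> Obj C"
  shows "Ident C X \<in> Arr C" "Dom C (Ident C X) = X" "Cod C (Ident C X) = X"
  using Ident_hom[OF assms] by (auto simp: homset_def)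

lemma Comp_simps [simp]:
  assumes "f \<in> Arr C" "g \<in> Arr C" "Dom C g = Cod C f"
  shows "g \<bullet> f \<in> Arr C" "Dom C (g \<bullet> f) = Dom C f" "Cod C (g \<bullet> f) = Cod C g"
  using Comp_hom[of f "Dom C f" "Cod C f" g "Cod C g"] assms by (auto simp: homset_def)

text \<open>Typing conditions are equations on \<open>Dom\<close> and \<open>Cod\<close> rather than
  memberships in \<open>homset\<close>, so that the simplifier can discharge them while it nests
  composites to the right.\<close>

lemma Comp_assoc_simp [simp]:
  assumes "f \<in> Arr C" "g \<in> Arr C" "h \<in> Arr C" "Dom C g = Cod C f" "Dom C h = Cod C g"
  shows "(h \<bullet> g) \<bullet> f = h \<bullet> (g \<bullet> f)"
  using Comp_assoc[of f "Dom C f" "Cod C f" g "Cod C g" h "Cod C h"] assms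
  by (auto simp: homset_def)

lemma Comp_Ident [simp]:
  assumes "f \<in> Arr C"
  shows "Dom C f = X \<Longrightarrow> f \<bullet> Ident C X = f" "Cod C f = X \<Longrightarrow> Ident C X \<bullet> f = f"
  using Comp_Ident_left[of f "Dom C f" "Cod C f"] Comp_Ident_right[of f "Dom C f" "Cod C f"] assms
  by (auto simp: homset_def)

lemma arr_inv_eqI:
  assumes "inverse_arrows C f g"
  shows "arr_inv C f = g"
  unfolding arr_inv_def
proof (rule the_equality[where a = g])
  fix h assume h: "inverse_arrows C f h"
  have "h = h \<bullet> (f \<bullet> g)"
    using assms h by (simp add: inverse_arrows_def homset_def)
  also have "\<dots> = (h \<bullet> f) \<bullet> g"
    using assms h by (subst Comp_assoc_simp) (auto simp add: inverse_arrows_def homset_def)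
  also have "\<dots> = g"
    using assms h by (simp add: inverse_arrows_def homset_def)
  finally show "h = g" .
qed (use assms in auto)

lemma inverse_arrows_arr_inv: "iso_arrow C f \<Longrightarrow> inverse_arrows C f (arr_inv C f)"
  using arr_inv_eqI by (auto simp: iso_arrow_def)

end

context monoidal_category
begin

lemma unit_Obj [simp]: "Tensor_unit C \<in> Obj C"
  by (rule Tensor_unit_in_Obj)

lemma Tensor_obj_simp [simp]: "X \<in> Obj C \<Longrightarrow> Y \<in> Obj C \<Longrightarrow> X \<odot> Y \<in> Obj C"
  by (rule Tensor_obj_closed)

lemma Tensor_arr_simps [simp]:
  assumes "f \<in> Arr C" "g \<in> Arr C"
  shows "f \<star> g \<in> Arr C" "Dom C (f \<star> g) = Dom C f \<odot> Dom C g"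
    "Cod C (f \<star> g) = Cod C f \<odot> Cod C g"
  using Tensor_arr_hom[of f "Dom C f" "Cod C f" g "Dom C g" "Cod C g"] assms
  by (auto simp: homset_def)

declare Tensor_Ident [simp]

lemma Assoc_simps [simp]:
  assumes "X \<in> Obj C" "Y \<in> Obj C" "Z \<in> Obj C"
  shows "Assoc C X Y Z \<in> Arr C" "Dom C (Assoc C X Y Z) = (X \<odot> Y) \<odot> Z"
    "Cod C (Assoc C X Y Z) = X \<odot> (Y \<odot> Z)"
  using Assoc_hom[OF assms] by (auto simp: homset_def)

lemma Unit_simps [simp]:
  assumes "X \<in> Obj C"
  shows "LUnit C X \<in> Arr C" "Dom C (LUnit C X) = Tensor_unit C \<odot> X" "Cod C (LUnit C X) = X"
    "RUnit C X \<in> Arr C" "Dom C (RUnit C X) = X \<odot> Tensor_unit C" "Cod C (RUnit C X) = X"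
  using LUnit_hom[OF assms] RUnit_hom[OF assms] by (auto simp: homset_def)

lemma Comp_Tensor:
  assumes "f \<in> Arr C" "f' \<in> Arr C" "g \<in> Arr C" "g' \<in> Arr C"
    "Dom C f' = Cod C f" "Dom C g' = Cod C g"
  shows "(f' \<star> g') \<bullet> (f \<star> g) = (f' \<bullet> f) \<star> (g' \<bullet> g)"
  using Tensor_Comp[of f "Dom C f" "Cod C f" f' "Cod C f'" g "Dom C g" "Cod C g" g' "Cod C g'"]
    assms by (auto simp: homset_def)

lemma whisker_left:
  assumes "f \<in> Arr C" "g \<in> Arr C" "Dom C g = Cod C f" "X \<in> Obj C"
  shows "Ident C X \<star> (g \<bullet> f) = (Ident C X \<star> g) \<bullet> (Ident C X \<star> f)"
  using assms by (simp add: Comp_Tensor)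

lemma whisker_right:
  assumes "f \<in> Arr C" "g \<in> Arr C" "Dom C g = Cod C f" "X \<in> Obj C"
  shows "(g \<bullet> f) \<star> Ident C X = (g \<star> Ident C X) \<bullet> (f \<star> Ident C X)"
  using assms by (simp add: Comp_Tensor)

lemma Assoc_nat:
  assumes "f \<in> Arr C" "g \<in> Arr C" "h \<in> Arr C"
    "Cod C f = X'" "Cod C g = Y'" "Cod C h = Z'"
  shows "Assoc C X' Y' Z' \<bullet> ((f \<star> g) \<star> h)
    = (f \<star> (g \<star> h)) \<bullet> Assoc C (Dom C f) (Dom C g) (Dom C h)"
  using Assoc_natural[of f "Dom C f" X' g "Dom C g" Y' h "Dom C h" Z'] assms
  by (auto simp: homset_def)

lemma LUnit_nat:
  assumes "f \<in> Arr C" "Cod C f = Y"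
  shows "LUnit C Y \<bullet> (Ident C (Tensor_unit C) \<star> f) = f \<bullet> LUnit C (Dom C f)"
  using LUnit_natural[of f "Dom C f" Y] assms by (auto simp: homset_def)

lemma RUnit_nat:
  assumes "f \<in> Arr C" "Cod C f = Y"
  shows "RUnit C Y \<bullet> (f \<star> Ident C (Tensor_unit C)) = f \<bullet> RUnit C (Dom C f)"
  using RUnit_natural[of f "Dom C f" Y] assms by (auto simp: homset_def)

lemma interchange:
  assumes "f \<in> Arr C" "g \<in> Arr C" "Dom C f = X" "Cod C f = X'" "Dom C g = Y" "Cod C g = Y'"
  shows "(f \<star> Ident C Y') \<bullet> (Ident C X \<star> g) = (Ident C X' \<star> g) \<bullet> (f \<star> Ident C Y)"
  using assms by (auto simp: Comp_Tensor)

end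

context gr_category
begin

lemma arr_inv_simps [simp]:
  assumes "f \<in> Arr C"
  shows "arr_inv C f \<in> Arr C" "Dom C (arr_inv C f) = Cod C f" "Cod C (arr_inv C f) = Dom C f"
    "arr_inv C f \<bullet> f = Ident C (Dom C f)" "f \<bullet> arr_inv C f = Ident C (Cod C f)"
  using inverse_arrows_arr_inv[OF all_arrows_iso[OF assms]]
  by (auto simp: inverse_arrows_def homset_def)

lemma arr_inv_cancel [simp]:
  assumes "f \<in> Arr C" "g \<in> Arr C"
  shows "Cod C g = Dom C f \<Longrightarrow> arr_inv C f \<bullet> (f \<bullet> g) = g"
    "Cod C g = Cod C f \<Longrightarrow> f \<bullet> (arr_inv C f \<bullet> g) = g"
  using assms by (simp_all flip: Comp_assoc_simp)

lemma arr_inv_unique: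
  assumes "f \<in> Arr C" "g \<in> Arr C" "Dom C g = Cod C f" "g \<bullet> f = Ident C (Dom C f)"
  shows "arr_inv C f = g"
proof -
  have "g = (g \<bullet> f) \<bullet> arr_inv C f"
    using assms(1-3) by simp
  then show ?thesis
    using assms by simp
qed

lemma arr_inv_arr_inv [simp]: "f \<in> Arr C \<Longrightarrow> arr_inv C (arr_inv C f) = f"
  by (rule arr_inv_unique) auto

lemma arr_inv_Ident [simp]: "X \<in> Obj C \<Longrightarrow> arr_inv C (Ident C X) = Ident C X"
  by (rule arr_inv_unique) auto

lemma arr_inv_Comp [simp]:
  assumes "f \<in> Arr C" "g \<in> Arr C" "Dom C g = Cod C f"
  shows "arr_inv C (g \<bullet> f) = arr_inv C f \<bullet> arr_inv C g"
  by (rule arr_inv_unique) (use assms in auto)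

lemma arr_inv_Tensor [simp]:
  assumes "f \<in> Arr C" "g \<in> Arr C"
  shows "arr_inv C (f \<star> g) = arr_inv C f \<star> arr_inv C g"
  by (rule arr_inv_unique) (use assms in \<open>auto simp: Comp_Tensor\<close>)

text \<open>\<open>arr_inv_Tensor\<close> moves inverses inside a tensor product, after which
  \<open>arr_inv_cancel\<close> no longer matches a whiskered arrow next to its inverse; these four
  rules do.\<close>

lemma arr_inv_whisker_cancel [simp]:
  assumes "f \<in> Arr C" "Y \<in> Obj C" "g \<in> Arr C"
  shows
    "Cod C g = Dom C f \<odot> Y \<Longrightarrow> (arr_inv C f \<star> Ident C Y) \<bullet> ((f \<star> Ident C Y) \<bullet> g) = g"
    "Cod C g = Cod C f \<odot> Y \<Longrightarrow> (f \<star> Ident C Y) \<bullet> ((arr_inv C f \<star> Ident C Y) \<bullet> g) = g"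
    "Cod C g = Y \<odot> Dom C f \<Longrightarrow> (Ident C Y \<star> arr_inv C f) \<bullet> ((Ident C Y \<star> f) \<bullet> g) = g"
    "Cod C g = Y \<odot> Cod C f \<Longrightarrow> (Ident C Y \<star> f) \<bullet> ((Ident C Y \<star> arr_inv C f) \<bullet> g) = g"
  using assms by (simp_all add: Comp_Tensor flip: Comp_assoc_simp)

lemma Comp_left_cancel:
  assumes "h \<bullet> f = h \<bullet> g" "h \<in> Arr C" "f \<in> Arr C" "g \<in> Arr C"
    "Cod C f = Dom C h" "Cod C g = Dom C h"
  shows "f = g"
proof -
  have "arr_inv C h \<bullet> (h \<bullet> f) = arr_inv C h \<bullet> (h \<bullet> g)"
    using assms(1) by simp
  then show ?thesis
    using assms(2-) by simp
qed

lemma Comp_right_cancel: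
  assumes "f \<bullet> h = g \<bullet> h" "h \<in> Arr C" "f \<in> Arr C" "g \<in> Arr C"
    "Dom C f = Cod C h" "Dom C g = Cod C h"
  shows "f = g"
proof -
  have "(f \<bullet> h) \<bullet> arr_inv C h = (g \<bullet> h) \<bullet> arr_inv C h"
    using assms(1) by simp
  then show ?thesis
    using assms(2-) by simp
qed

end

section \<open>Scalars\<close>

context gr_category
begin

text \<open>Two opposite sides of a commutative square are inverted. Naturality of a constraint
  passes to its inverse in this way, and so do the naturality axioms of the opposite
  category.\<close>

lemma square_arr_inv:
  assumes "k \<bullet> f = g \<bullet> h" "k \<in> Arr C" "f \<in> Arr C" "g \<in> Arr C" "h \<in> Arr C"
    "Cod C f = Dom C k" "Cod C h = Dom C g"
  shows "arr_inv C k \<bullet> g = f \<bullet> arr_inv C h"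
proof -
  have D: "Dom C f = Dom C h" "Cod C k = Cod C g"
    using assms by (metis Comp_simps(2,3))+
  have "arr_inv C k \<bullet> g = arr_inv C k \<bullet> ((g \<bullet> h) \<bullet> arr_inv C h)"
    using assms(2-) D by simp
  also have "\<dots> = arr_inv C k \<bullet> ((k \<bullet> f) \<bullet> arr_inv C h)"
    using assms(1) by simp
  also have "\<dots> = f \<bullet> arr_inv C h"
    using assms(2-) D by simp
  finally show ?thesis .
qed

lemma Aut_unit_carrier [simp]:
  "a \<in> carrier (Aut_unit C) \<longleftrightarrow>
    a \<in> Arr C \<and> Dom C a = Tensor_unit C \<and> Cod C a = Tensor_unit C"
  using all_arrows_iso by (auto simp: Aut_unit_def homset_def)

lemma right_mult_simps [simp]:
  assumes "a \<in> carrier (Aut_unit C)" "X \<in> Obj C"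
  shows "right_mult C X a \<in> Arr C" "Dom C (right_mult C X a) = X" "Cod C (right_mult C X a) = X"
  using assms by (simp_all add: right_mult_def)

lemma left_mult_simps [simp]:
  assumes "a \<in> carrier (Aut_unit C)" "X \<in> Obj C"
  shows "left_mult C X a \<in> Arr C" "Dom C (left_mult C X a) = X" "Cod C (left_mult C X a) = X"
  using assms by (simp_all add: left_mult_def)

text \<open>For fixed \<open>a\<close> these automorphisms form an endomorphism of the identity
  functor: the left unit constraint is natural, and \<open>a\<close> and \<open>f\<close> act on
  different tensor factors.\<close>

lemma right_mult_nat:
  assumes a: "a \<in> carrier (Aut_unit C)" and f: "f \<in> Arr C" "Dom C f = X" "Cod C f = Y"
  shows "right_mult C Y a \<bullet> f = f \<bullet> right_mult C X a"
proof -
  let ?I = "Ident C (Tensor_unit C)"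
  have [simp]: "X \<in> Obj C" "Y \<in> Obj C"
    using f by auto
  have 1: "LUnit C Y \<bullet> (?I \<star> f) = f \<bullet> LUnit C X"
    using LUnit_nat f by auto
  then have 2: "arr_inv C (LUnit C Y) \<bullet> f = (?I \<star> f) \<bullet> arr_inv C (LUnit C X)"
    using f by (intro square_arr_inv) auto
  have "right_mult C Y a \<bullet> f = LUnit C Y \<bullet> ((a \<star> Ident C Y) \<bullet> (arr_inv C (LUnit C Y) \<bullet> f))"
    using a f by (simp add: right_mult_def)
  also have "\<dots> = LUnit C Y \<bullet> (((a \<star> Ident C Y) \<bullet> (?I \<star> f)) \<bullet> arr_inv C (LUnit C X))"
    using a f by (simp add: 2)
  also have "(a \<star> Ident C Y) \<bullet> (?I \<star> f) = (?I \<star> f) \<bullet> (a \<star> Ident C X)"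
    using a f by (intro interchange) auto
  also have "LUnit C Y \<bullet> ((?I \<star> f) \<bullet> (a \<star> Ident C X) \<bullet> arr_inv C (LUnit C X))
      = (LUnit C Y \<bullet> (?I \<star> f)) \<bullet> ((a \<star> Ident C X) \<bullet> arr_inv C (LUnit C X))"
    using a f by simp
  also have "\<dots> = f \<bullet> right_mult C X a"
    unfolding 1 using a f by (simp add: right_mult_def)
  finally show ?thesis .
qed

lemma left_mult_nat:
  assumes a: "a \<in> carrier (Aut_unit C)" and f: "f \<in> Arr C" "Dom C f = X" "Cod C f = Y"
  shows "left_mult C Y a \<bullet> f = f \<bullet> left_mult C X a"
proof -
  let ?I = "Ident C (Tensor_unit C)"
  have [simp]: "X \<in> Obj C" "Y \<in> Obj C"
    using f by auto
  have 1: "RUnit C Y \<bullet> (f \<star> ?I) = f \<bullet> RUnit C X"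
    using RUnit_nat f by auto
  then have 2: "arr_inv C (RUnit C Y) \<bullet> f = (f \<star> ?I) \<bullet> arr_inv C (RUnit C X)"
    using f by (intro square_arr_inv) auto
  have "left_mult C Y a \<bullet> f = RUnit C Y \<bullet> ((Ident C Y \<star> a) \<bullet> (arr_inv C (RUnit C Y) \<bullet> f))"
    using a f by (simp add: left_mult_def)
  also have "\<dots> = RUnit C Y \<bullet> (((Ident C Y \<star> a) \<bullet> (f \<star> ?I)) \<bullet> arr_inv C (RUnit C X))"
    using a f by (simp add: 2)
  also have "(Ident C Y \<star> a) \<bullet> (f \<star> ?I) = (f \<star> ?I) \<bullet> (Ident C X \<star> a)"
    using a f by (intro interchange[symmetric]) auto
  also have "RUnit C Y \<bullet> ((f \<star> ?I) \<bullet> (Ident C X \<star> a) \<bullet> arr_inv C (RUnit C X))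
      = (RUnit C Y \<bullet> (f \<star> ?I)) \<bullet> ((Ident C X \<star> a) \<bullet> arr_inv C (RUnit C X))"
    using a f by simp
  also have "\<dots> = f \<bullet> left_mult C X a"
    unfolding 1 using a f by (simp add: left_mult_def)
  finally show ?thesis .
qed

text \<open>
  The two trivialisations \<open>I(XY) \<rightarrow> XY\<close> that occur differ by an automorphism \<open>t\<close> of \<open>XY\<close>, which
  commutes with scalars by naturality; so Kelly's coherence for the left unit is not needed.
\<close>

lemma right_mult_Tensor:
  assumes a: "a \<in> carrier (Aut_unit C)" and [simp]: "X \<in> Obj C" "Y \<in> Obj C"
  shows "right_mult C X a \<star> Ident C Y = right_mult C (X \<odot> Y) a"
proof -
  let ?I = "Tensor_unit C" and ?XY = "X \<odot> Y" and ?r = "right_mult C X a \<star> Ident C Y"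
  define \<theta> where "\<theta> = (LUnit C X \<star> Ident C Y) \<bullet> arr_inv C (Assoc C ?I X Y)"
  define t where "t = \<theta> \<bullet> arr_inv C (LUnit C ?XY)"
  have [simp]: "\<theta> \<in> Arr C" "Dom C \<theta> = ?I \<odot> ?XY" "Cod C \<theta> = ?XY"
    by (auto simp: \<theta>_def)
  have [simp]: "t \<in> Arr C" "Dom C t = ?XY" "Cod C t = ?XY"
    by (auto simp: t_def)
  have nat: "arr_inv C (Assoc C ?I X Y) \<bullet> (a \<star> Ident C ?XY)
      = ((a \<star> Ident C X) \<star> Ident C Y) \<bullet> arr_inv C (Assoc C ?I X Y)"
    using a Assoc_nat[of a "Ident C X" "Ident C Y" ?I X Y] by (intro square_arr_inv) auto
  have "?r \<bullet> \<theta> = (LUnit C X \<star> Ident C Y) \<bullet> (((a \<star> Ident C X) \<star> Ident C Y)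
      \<bullet> arr_inv C (Assoc C ?I X Y))"
    using a by (simp add: right_mult_def \<theta>_def whisker_right)
  also have "\<dots> = \<theta> \<bullet> (a \<star> Ident C ?XY)"
    using a by (simp add: \<theta>_def nat)
  finally have *: "?r \<bullet> \<theta> = \<theta> \<bullet> (a \<star> Ident C ?XY)" .
  have "?r \<bullet> t = (?r \<bullet> \<theta>) \<bullet> arr_inv C (LUnit C ?XY)"
    using a by (simp add: t_def)
  also have "\<dots> = t \<bullet> right_mult C ?XY a"
    unfolding * using a by (simp add: t_def right_mult_def)
  also have "\<dots> = right_mult C ?XY a \<bullet> t"
    using a by (intro right_mult_nat[symmetric]) auto
  finally show ?thesis
    by (rule Comp_right_cancel) (use a in auto)
qed

section \<open>Right multiplication as an isomorphism from Aut(I) to Aut(X)\<close>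

lemma right_mult_Comp:
  assumes "a \<in> carrier (Aut_unit C)" "b \<in> carrier (Aut_unit C)" "X \<in> Obj C"
  shows "right_mult C X (a \<bullet> b) = right_mult C X a \<bullet> right_mult C X b"
  using assms by (simp add: right_mult_def whisker_right)

lemma right_mult_Ident [simp]: "X \<in> Obj C \<Longrightarrow> right_mult C X (Ident C (Tensor_unit C)) = Ident C X"
  by (simp add: right_mult_def)

text \<open>Tensoring once more with an inverse \<open>Y'\<close> of \<open>Y\<close> recovers
  \<open>f \<star> Ident C I\<close>, up to arrows that depend only on the source and target of
  \<open>f\<close>; naturality of the right unit constraint then recovers \<open>f\<close>.\<close>

lemma Tensor_right_faithful:
  assumes eq: "f \<star> Ident C Y = g \<star> Ident C Y" and Y: "Y \<in> Obj C"
    and fg: "f \<in> Arr C" "g \<in> Arr C" "Dom C f = Dom C g" "Cod C f = Cod C g"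
  shows "f = g"
proof -
  let ?I = "Tensor_unit C"
  obtain Y' where Y': "Y' \<in> Obj C" "isomorphic C (Y \<odot> Y') ?I"
    using object_invertible[OF Y] by auto
  then obtain h where h: "h \<in> Arr C" "Dom C h = Y \<odot> Y'" "Cod C h = ?I"
    by (auto simp: isomorphic_def homset_def)
  have *: "f' \<star> Ident C ?I = (Ident C (Cod C f') \<star> h)
      \<bullet> (Assoc C (Cod C f') Y Y' \<bullet> (((f' \<star> Ident C Y) \<star> Ident C Y')
      \<bullet> (arr_inv C (Assoc C (Dom C f') Y Y') \<bullet> (Ident C (Dom C f') \<star> arr_inv C h))))"
    if f': "f' \<in> Arr C" for f'
  proof -
    have "Assoc C (Cod C f') Y Y' \<bullet> (((f' \<star> Ident C Y) \<star> Ident C Y')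
        \<bullet> (arr_inv C (Assoc C (Dom C f') Y Y') \<bullet> (Ident C (Dom C f') \<star> arr_inv C h)))
      = (Assoc C (Cod C f') Y Y' \<bullet> ((f' \<star> Ident C Y) \<star> Ident C Y'))
        \<bullet> (arr_inv C (Assoc C (Dom C f') Y Y') \<bullet> (Ident C (Dom C f') \<star> arr_inv C h))"
      using f' Y Y'(1) h by simp
    also have "\<dots> = (f' \<star> Ident C (Y \<odot> Y')) \<bullet> (Ident C (Dom C f') \<star> arr_inv C h)"
      using f' Y Y'(1) h by (simp add: Assoc_nat)
    finally show ?thesis
      using f' Y Y'(1) h by (simp add: Comp_Tensor)
  qed
  have "f \<star> Ident C ?I = g \<star> Ident C ?I"
    using *[OF fg(1)] *[OF fg(2)] eq fg by simp
  then have "f \<bullet> RUnit C (Dom C f) = g \<bullet> RUnit C (Dom C f)"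
    using RUnit_nat[OF fg(1) refl] RUnit_nat[OF fg(2) refl] fg by simp
  then show ?thesis
    by (rule Comp_right_cancel) (use fg in auto)
qed

text \<open>Naturality of the right unit constraint r gives \<open>a \<star> Ident C I\<close> as a
  conjugate of \<open>a\<close> by r, while \<open>right_mult\<close> conjugates by the left one, l;
  together this is conjugation by l after the inverse of r. Bijectivity at every object is reduced
  to this case.\<close>

lemma right_mult_unit:
  obtains t where "t \<in> carrier (Aut_unit C)"
    "\<And>a. a \<in> carrier (Aut_unit C) \<Longrightarrow> right_mult C (Tensor_unit C) a = t \<bullet> (a \<bullet> arr_inv C t)"
proof
  let ?I = "Tensor_unit C"
  define t where "t = LUnit C ?I \<bullet> arr_inv C (RUnit C ?I)"
  show "t \<in> carrier (Aut_unit C)"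
    by (simp add: t_def)
  fix a assume a: "a \<in> carrier (Aut_unit C)"
  have "RUnit C ?I \<bullet> (a \<star> Ident C ?I) = a \<bullet> RUnit C ?I"
    using RUnit_nat a by auto
  then have "arr_inv C (RUnit C ?I) \<bullet> a = (a \<star> Ident C ?I) \<bullet> arr_inv C (RUnit C ?I)"
    using a by (intro square_arr_inv) auto
  then have "(arr_inv C (RUnit C ?I) \<bullet> a) \<bullet> RUnit C ?I
      = ((a \<star> Ident C ?I) \<bullet> arr_inv C (RUnit C ?I)) \<bullet> RUnit C ?I"
    by simp
  then have "a \<star> Ident C ?I = arr_inv C (RUnit C ?I) \<bullet> (a \<bullet> RUnit C ?I)"
    using a by simp
  then show "right_mult C ?I a = t \<bullet> (a \<bullet> arr_inv C t)"
    using a by (simp add: right_mult_def t_def)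
qed

lemma unit_cover:
  assumes "X \<in> Obj C"
  obtains Y h where "Y \<in> Obj C" "h \<in> Arr C" "Dom C h = X \<odot> Y" "Cod C h = Tensor_unit C"
  using object_invertible[OF assms] by (auto simp: isomorphic_def homset_def)

text \<open>Tensoring with \<open>Y\<close> and moving along \<open>h\<close> from
  \<open>X \<odot> Y\<close> to the unit turns the scalar on \<open>X\<close> into the scalar on the
  unit, where it is a conjugate of \<open>a\<close>.\<close>

lemma right_mult_inj:
  assumes eq: "right_mult C X a = right_mult C X b" and X: "X \<in> Obj C"
    and a: "a \<in> carrier (Aut_unit C)" and b: "b \<in> carrier (Aut_unit C)"
  shows "a = b"
proof -
  let ?I = "Tensor_unit C"
  obtain Y h where Y: "Y \<in> Obj C" and h: "h \<in> Arr C" "Dom C h = X \<odot> Y" "Cod C h = ?I"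
    using unit_cover[OF X] .
  have "right_mult C (X \<odot> Y) a = right_mult C (X \<odot> Y) b"
    using right_mult_Tensor[OF a X Y] right_mult_Tensor[OF b X Y] eq by simp
  then have "right_mult C ?I a \<bullet> h = right_mult C ?I b \<bullet> h"
    using right_mult_nat[OF a h] right_mult_nat[OF b h] by simp
  then have *: "right_mult C ?I a = right_mult C ?I b"
    by (rule Comp_right_cancel) (use a b h in auto)
  obtain t where t: "t \<in> carrier (Aut_unit C)"
    "\<And>a. a \<in> carrier (Aut_unit C) \<Longrightarrow> right_mult C ?I a = t \<bullet> (a \<bullet> arr_inv C t)"
    using right_mult_unit by blast
  have "t \<bullet> (a \<bullet> arr_inv C t) = t \<bullet> (b \<bullet> arr_inv C t)"
    using * t(2)[OF a] t(2)[OF b] by simp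
  then have "a \<bullet> arr_inv C t = b \<bullet> arr_inv C t"
    by (rule Comp_left_cancel) (use t(1) a b in auto)
  then show ?thesis
    by (rule Comp_right_cancel) (use t(1) a b in auto)
qed

lemma right_mult_surj:
  assumes f: "f \<in> Arr C" "Dom C f = X" "Cod C f = X"
  obtains a where "a \<in> carrier (Aut_unit C)" "right_mult C X a = f"
proof -
  let ?I = "Tensor_unit C"
  have X: "X \<in> Obj C"
    using f by auto
  obtain Y h where Y: "Y \<in> Obj C" and h: "h \<in> Arr C" "Dom C h = X \<odot> Y" "Cod C h = ?I"
    using unit_cover[OF X] .
  obtain t where t: "t \<in> carrier (Aut_unit C)"
    "\<And>a. a \<in> carrier (Aut_unit C) \<Longrightarrow> right_mult C ?I a = t \<bullet> (a \<bullet> arr_inv C t)"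
    using right_mult_unit by blast
  \<comment> \<open>\<open>g\<close> is \<open>f \<star> Ident C Y\<close> moved to the unit along
    \<open>h\<close>, and \<open>a\<close> is its preimage under conjugation by \<open>t\<close>.
    Going back, \<open>Tensor_right_faithful\<close> removes the factor \<open>Y\<close>.\<close>
  define g where "g = h \<bullet> ((f \<star> Ident C Y) \<bullet> arr_inv C h)"
  define a where "a = arr_inv C t \<bullet> (g \<bullet> t)"
  have g: "g \<in> Arr C" "Dom C g = ?I" "Cod C g = ?I"
    using f h Y by (auto simp: g_def)
  have a: "a \<in> carrier (Aut_unit C)"
    using t(1) g by (auto simp: a_def)
  have "right_mult C ?I a = g"
    using t g by (simp add: t(2)[OF a] a_def)
  then have "h \<bullet> right_mult C (X \<odot> Y) a = h \<bullet> (f \<star> Ident C Y)"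
    using right_mult_nat[OF a h] f h Y by (simp add: g_def)
  then have "right_mult C (X \<odot> Y) a = f \<star> Ident C Y"
    by (rule Comp_left_cancel) (use a h f X Y in auto)
  then have "right_mult C X a \<star> Ident C Y = f \<star> Ident C Y"
    using right_mult_Tensor a X Y by simp
  then have "right_mult C X a = f"
    by (rule Tensor_right_faithful) (use a f X Y in auto)
  with a show ?thesis
    by (rule that)
qed

text \<open>For commutativity, every automorphism of the unit is itself a scalar
  \<open>right_mult C I a'\<close>, and scalars commute with all endomorphisms by
  naturality.\<close>

lemma Aut_unit_comm_group: "comm_group (Aut_unit C)"
proof (rule group.group_comm_groupI)
  have sel [simp]: "mult (Aut_unit C) = Comp C" "one (Aut_unit C) = Ident C (Tensor_unit C)"
    by (simp_all add: Aut_unit_def)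
  show "group (Aut_unit C)"
  proof (rule groupI)
    fix a assume "a \<in> carrier (Aut_unit C)"
    then show "\<exists>b \<in> carrier (Aut_unit C). b \<otimes>\<^bsub>Aut_unit C\<^esub> a = \<one>\<^bsub>Aut_unit C\<^esub>"
      by (intro bexI[of _ "arr_inv C a"]) auto
  qed auto
  fix a b assume a: "a \<in> carrier (Aut_unit C)" and b: "b \<in> carrier (Aut_unit C)"
  then obtain a' where "a' \<in> carrier (Aut_unit C)" "right_mult C (Tensor_unit C) a' = a"
    using right_mult_surj[of a "Tensor_unit C"] by auto
  then show "a \<otimes>\<^bsub>Aut_unit C\<^esub> b = b \<otimes>\<^bsub>Aut_unit C\<^esub> a"
    using right_mult_nat[of a' b "Tensor_unit C" "Tensor_unit C"] b by auto
qed

section \<open>The action of isomorphism classes on Aut(I)\<close>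

lemma left_mult_eq_right_mult_iso:
  assumes f: "f \<in> Arr C" "Dom C f = X" "Cod C f = Y"
    and a: "a \<in> carrier (Aut_unit C)" and b: "b \<in> carrier (Aut_unit C)"
    and eq: "left_mult C X a = right_mult C X b"
  shows "left_mult C Y a = right_mult C Y b"
proof -
  have "left_mult C Y a \<bullet> f = right_mult C Y b \<bullet> f"
    using left_mult_nat[OF a f] right_mult_nat[OF b f] eq by simp
  then show ?thesis
    by (rule Comp_right_cancel) (use f a b in auto)
qed

lemma obj_action_eqI:
  assumes "X \<in> Obj C" "a \<in> carrier (Aut_unit C)" "b \<in> carrier (Aut_unit C)"
    "left_mult C X a = right_mult C X b"
  shows "obj_action C X a = b"
  unfolding obj_action_def assms(4)
  by (rule the_inv_into_f_f) (use assms right_mult_inj in \<open>auto simp: inj_on_def\<close>)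

text \<open>Evaluates the inverse function and \<open>the_elem\<close> hidden in
  \<open>pi0_action\<close>: injectivity of right multiplication fixes the value at one object, and
  naturality of both multiplications makes it the same on the whole class.\<close>

lemma pi0_action_eqI:
  assumes X: "X \<in> Obj C" and a: "a \<in> carrier (Aut_unit C)" and b: "b \<in> carrier (Aut_unit C)"
    and eq: "left_mult C X a = right_mult C X b"
  shows "pi0_action C (iso_class C X) a = b"
proof -
  have "obj_action C Y a = b" if Y: "Y \<in> iso_class C X" for Y
  proof -
    from Y obtain f where f: "f \<in> Arr C" "Dom C f = X" "Cod C f = Y"
      by (auto simp: iso_class_def isomorphic_def homset_def)
    show ?thesis
      using left_mult_eq_right_mult_iso[OF f a b eq] f a b by (intro obj_action_eqI) auto
  qed
  moreover have "X \<in> iso_class C X"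
    using X Ident_hom[OF X] all_arrows_iso[of "Ident C X"]
    by (auto simp: iso_class_def isomorphic_def)
  ultimately have "(\<lambda>Y. obj_action C Y a) ` iso_class C X = {b}"
    by auto
  then show ?thesis
    by (simp add: pi0_action_def)
qed

text \<open>Turns a statement about the module structure into an equation in Aut(X): where the class
  acts trivially, left and right multiplication coincide.\<close>

lemma left_mult_eq_right_mult_pi0_action:
  assumes X: "X \<in> Obj C" and a: "a \<in> carrier (Aut_unit C)"
  shows "left_mult C X a = right_mult C X (pi0_action C (iso_class C X) a)"
proof -
  obtain b where "b \<in> carrier (Aut_unit C)" "right_mult C X b = left_mult C X a"
    using right_mult_surj[of "left_mult C X a" X] X a by auto
  then show ?thesis
    using pi0_action_eqI[OF X a] by auto
qed

end

text \<open>The trivial module structure, stated for objects instead of classes. In this form it is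
  self-dual and passes to the opposite category by rewriting.\<close>

locale central_gr_category = gr_category C for C (structure) +
  assumes left_mult_eq_right_mult:
    "\<lbrakk>X \<in> Obj C; a \<in> carrier (Aut_unit C)\<rbrakk> \<Longrightarrow> left_mult C X a = right_mult C X a"

context central_gr_category
begin

text \<open>The triangle identity trades the left unit constraint of \<open>Y\<close> under
  \<open>X\<close> for the right unit constraint of \<open>X\<close>, so the left side equals
  \<open>left_mult C X a \<star> Ident C Y\<close>. There the left multiplication may be replaced by
  the right one.\<close>

lemma right_mult_Tensor_left:
  assumes a: "a \<in> carrier (Aut_unit C)" and [simp]: "X \<in> Obj C" "Y \<in> Obj C"
  shows "Ident C X \<star> right_mult C Y a = right_mult C (X \<odot> Y) a"
proof -
  let ?I = "Tensor_unit C" and ?\<alpha> = "Assoc C X (Tensor_unit C) Y"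
  have tri: "Ident C X \<star> LUnit C Y = (RUnit C X \<star> Ident C Y) \<bullet> arr_inv C ?\<alpha>"
    by (simp flip: triangle)
  have tri': "Ident C X \<star> arr_inv C (LUnit C Y) = ?\<alpha> \<bullet> (arr_inv C (RUnit C X) \<star> Ident C Y)"
    using arg_cong[OF tri, of "arr_inv C"] by simp
  have nat: "?\<alpha> \<bullet> ((Ident C X \<star> a) \<star> Ident C Y) = (Ident C X \<star> (a \<star> Ident C Y)) \<bullet> ?\<alpha>"
    using Assoc_nat[of "Ident C X" a "Ident C Y" X ?I Y] a by simp
  have "Ident C X \<star> right_mult C Y a
      = (RUnit C X \<star> Ident C Y) \<bullet> (arr_inv C ?\<alpha> \<bullet> (((Ident C X \<star> (a \<star> Ident C Y)) \<bullet> ?\<alpha>)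
        \<bullet> (arr_inv C (RUnit C X) \<star> Ident C Y)))"
    using a by (simp add: right_mult_def whisker_left tri tri')
  also have "\<dots> = left_mult C X a \<star> Ident C Y"
    using a by (simp add: left_mult_def whisker_right flip: nat)
  finally show ?thesis
    using a by (simp add: left_mult_eq_right_mult right_mult_Tensor)
qed

end

section \<open>The opposite category\<close>

text \<open>Only composition is reversed, not the tensor product, and the constraints are inverted
  to keep their direction. A swap for \<open>P\<close>, \<open>Q\<close> becomes a swap for
  \<open>Q\<close>, \<open>P\<close>, so the two variables of the commutator change places.\<close>

definition opposite :: "('o, 'm, 'z) moncat_scheme \<Rightarrow> ('o, 'm) moncat"
  where "opposite C =
    \<lparr>Obj = Obj C, Arr = Arr C, Dom = Cod C, Cod = Dom C, Ident = Ident C,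
     Comp = (\<lambda>g f. f \<bullet>\<^bsub>C\<^esub> g), Tensor_obj = Tensor_obj C, Tensor_arr = Tensor_arr C,
     Tensor_unit = Tensor_unit C, Assoc = (\<lambda>X Y Z. arr_inv C (Assoc C X Y Z)),
     LUnit = (\<lambda>X. arr_inv C (LUnit C X)), RUnit = (\<lambda>X. arr_inv C (RUnit C X))\<rparr>"

lemma opposite_simps [simp]:
  "Obj (opposite C) = Obj C" "Arr (opposite C) = Arr C" "Dom (opposite C) = Cod C"
  "Cod (opposite C) = Dom C" "Ident (opposite C) = Ident C"
  "g \<bullet>\<^bsub>opposite C\<^esub> f = f \<bullet>\<^bsub>C\<^esub> g" "X \<odot>\<^bsub>opposite C\<^esub> Y = X \<odot>\<^bsub>C\<^esub> Y" "f \<star>\<^bsub>opposite C\<^esub> g = f \<star>\<^bsub>C\<^esub> g"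
  "Tensor_unit (opposite C) = Tensor_unit C"
  "Assoc (opposite C) X Y Z = arr_inv C (Assoc C X Y Z)"
  "LUnit (opposite C) X = arr_inv C (LUnit C X)" "RUnit (opposite C) X = arr_inv C (RUnit C X)"
  by (simp_all add: opposite_def)

lemma homset_opposite [simp]: "homset (opposite C) X Y = homset C Y X"
  by (auto simp: homset_def)

lemma inverse_arrows_opposite [simp]: "inverse_arrows (opposite C) = inverse_arrows C"
  by (auto simp: inverse_arrows_def fun_eq_iff)

lemma arr_inv_opposite [simp]: "arr_inv (opposite C) = arr_inv C"
  by (simp add: arr_inv_def fun_eq_iff)

lemma iso_arrow_opposite [simp]: "iso_arrow (opposite C) = iso_arrow C"
  by (simp add: iso_arrow_def fun_eq_iff)

context gr_category
begin

text \<open>As the constraints are inverted, naturality is \<open>square_arr_inv\<close>, while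
  pentagon and triangle come from applying \<open>arr_inv\<close> to both sides, which reverses the
  order of the factors.\<close>

lemma opposite_gr_category: "gr_category (opposite C)"
proof
  fix f X X' g Y Y' h Z Z'
  assume "f \<in> homset (opposite C) X X'" "g \<in> homset (opposite C) Y Y'" "h \<in> homset (opposite C) Z Z'"
  then show "Assoc (opposite C) X' Y' Z' \<bullet>\<^bsub>opposite C\<^esub> (f \<star>\<^bsub>opposite C\<^esub> g \<star>\<^bsub>opposite C\<^esub> h)
    = f \<star>\<^bsub>opposite C\<^esub> (g \<star>\<^bsub>opposite C\<^esub> h) \<bullet>\<^bsub>opposite C\<^esub> Assoc (opposite C) X Y Z"
    using Assoc_nat[of f g h] by (auto simp: homset_def intro!: square_arr_inv[symmetric])
next
  fix f X Y
  assume "f \<in> homset (opposite C) X Y"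
  then show "LUnit (opposite C) Y \<bullet>\<^bsub>opposite C\<^esub> (Ident (opposite C) (Tensor_unit (opposite C)) \<star>\<^bsub>opposite C\<^esub> f)
    = f \<bullet>\<^bsub>opposite C\<^esub> LUnit (opposite C) X"
    "RUnit (opposite C) Y \<bullet>\<^bsub>opposite C\<^esub> (f \<star>\<^bsub>opposite C\<^esub> Ident (opposite C) (Tensor_unit (opposite C)))
    = f \<bullet>\<^bsub>opposite C\<^esub> RUnit (opposite C) X"
    using LUnit_nat[of f] RUnit_nat[of f] by (auto simp: homset_def intro!: square_arr_inv[symmetric])
next
  fix W X Y Z
  assume "W \<in> Obj (opposite C)" "X \<in> Obj (opposite C)" "Y \<in> Obj (opposite C)" "Z \<in> Obj (opposite C)"
  then show "Assoc (opposite C) W X (Y \<odot>\<^bsub>opposite C\<^esub> Z) \<bullet>\<^bsub>opposite C\<^esub>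
      Assoc (opposite C) (W \<odot>\<^bsub>opposite C\<^esub> X) Y Z
    = (Ident (opposite C) W \<star>\<^bsub>opposite C\<^esub> Assoc (opposite C) X Y Z) \<bullet>\<^bsub>opposite C\<^esub>
      Assoc (opposite C) W (X \<odot>\<^bsub>opposite C\<^esub> Y) Z \<bullet>\<^bsub>opposite C\<^esub>
      (Assoc (opposite C) W X Y \<star>\<^bsub>opposite C\<^esub> Ident (opposite C) Z)"
    using arg_cong[OF pentagon, of W X Y Z "arr_inv C"] by simp
next
  fix X Y
  assume "X \<in> Obj (opposite C)" "Y \<in> Obj (opposite C)"
  then show "(Ident (opposite C) X \<star>\<^bsub>opposite C\<^esub> LUnit (opposite C) Y) \<bullet>\<^bsub>opposite C\<^esub>
      Assoc (opposite C) X (Tensor_unit (opposite C)) Y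
    = RUnit (opposite C) X \<star>\<^bsub>opposite C\<^esub> Ident (opposite C) Y"
    using arg_cong[OF triangle, of X Y "arr_inv C"] by simp
next
  fix X
  assume "X \<in> Obj (opposite C)"
  then obtain Y f g where Y: "Y \<in> Obj C" "f \<in> homset C (X \<odot> Y) (Tensor_unit C)"
    "g \<in> homset C (Y \<odot> X) (Tensor_unit C)"
    using object_invertible[of X] by (simp add: isomorphic_def) blast
  then have "arr_inv C f \<in> homset C (Tensor_unit C) (X \<odot> Y)" "iso_arrow C (arr_inv C f)"
    "arr_inv C g \<in> homset C (Tensor_unit C) (Y \<odot> X)" "iso_arrow C (arr_inv C g)"
    using all_arrows_iso by (auto simp: homset_def)
  with Y(1) show "\<exists>Y \<in> Obj (opposite C).
      isomorphic (opposite C) (X \<odot>\<^bsub>opposite C\<^esub> Y) (Tensor_unit (opposite C)) \<and>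
      isomorphic (opposite C) (Y \<odot>\<^bsub>opposite C\<^esub> X) (Tensor_unit (opposite C))"
    by (auto simp: isomorphic_def)
qed (auto simp: homset_def Comp_Tensor all_arrows_iso)

lemma Aut_unit_opposite [simp]: "carrier (Aut_unit (opposite C)) = carrier (Aut_unit C)"
  by (auto simp: Aut_unit_def homset_def)

lemma right_mult_opposite [simp]:
  assumes "X \<in> Obj C" "a \<in> carrier (Aut_unit C)"
  shows "right_mult (opposite C) X a = right_mult C X a"
    "left_mult (opposite C) X a = left_mult C X a"
  using assms by (simp_all add: right_mult_def left_mult_def)

end

lemma (in central_gr_category) opposite_central: "central_gr_category (opposite C)"
proof -
  interpret op: gr_category "opposite C"
    by (rule opposite_gr_category)
  show ?thesis
    by unfold_locales (simp del: Aut_unit_carrier op.Aut_unit_carrier add: left_mult_eq_right_mult)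
qed

section \<open>Products and transport of swaps\<close>

text \<open>The inner part of \<open>commutator_add1\<close>, a composite as in the hexagon axiom of
  a braiding: \<open>Q\<close> moves past \<open>P\<close> by \<open>u\<close> and then past
  \<open>P'\<close> by \<open>v\<close>.\<close>

definition half_braid ::
    "('o, 'm, 'z) moncat_scheme \<Rightarrow> 'o \<Rightarrow> 'o \<Rightarrow> 'o \<Rightarrow> 'm \<Rightarrow> 'm \<Rightarrow> 'm"
  where "half_braid C P P' Q u v =
      arr_inv C (Assoc C P P' Q)
    \<bullet>\<^bsub>C\<^esub> (Ident C P \<star>\<^bsub>C\<^esub> v)
    \<bullet>\<^bsub>C\<^esub> Assoc C P Q P'
    \<bullet>\<^bsub>C\<^esub> (u \<star>\<^bsub>C\<^esub> Ident C P')
    \<bullet>\<^bsub>C\<^esub> arr_inv C (Assoc C Q P P')"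

text \<open>Changes the first object of a swap along \<open>h\<close>. The same formula in
  \<open>opposite C\<close> changes the second object.\<close>

definition transport :: "('o, 'm, 'z) moncat_scheme \<Rightarrow> 'o \<Rightarrow> 'm \<Rightarrow> 'm \<Rightarrow> 'm"
  where "transport C Q h u = (h \<star>\<^bsub>C\<^esub> Ident C Q) \<bullet>\<^bsub>C\<^esub> u \<bullet>\<^bsub>C\<^esub> (Ident C Q \<star>\<^bsub>C\<^esub> arr_inv C h)"

definition tail_action ::
    "('o, 'm, 'z) moncat_scheme \<Rightarrow> 'o \<Rightarrow> 'o \<Rightarrow> 'm \<Rightarrow> 'o \<Rightarrow> 'm"
  where "tail_action C P Q u Z =
    Assoc C P Q Z \<bullet>\<^bsub>C\<^esub> (u \<star>\<^bsub>C\<^esub> Ident C Z) \<bullet>\<^bsub>C\<^esub> arr_inv C (Assoc C Q P Z)"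

abbreviation swap_arrow :: "('o, 'm, 'z) moncat_scheme \<Rightarrow> 'o \<Rightarrow> 'o \<Rightarrow> 'm \<Rightarrow> bool"
  where "swap_arrow C P Q u \<equiv> u \<in> Arr C \<and> Dom C u = Q \<odot>\<^bsub>C\<^esub> P \<and> Cod C u = P \<odot>\<^bsub>C\<^esub> Q"

context gr_category
begin

lemma half_braid_swap:
  assumes "P \<in> Obj C" "P' \<in> Obj C" "Q \<in> Obj C" "swap_arrow C P Q u" "swap_arrow C P' Q v"
  shows "swap_arrow C (P \<odot> P') Q (half_braid C P P' Q u v)"
  using assms by (simp add: half_braid_def)

lemma transport_swap:
  assumes "h \<in> Arr C" "Q \<in> Obj C" "swap_arrow C (Dom C h) Q u" "Cod C h = R"
  shows "swap_arrow C R Q (transport C Q h u)"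
  using assms by (simp add: transport_def)

section \<open>Swaps acting on words with a tail\<close>

lemma tail_action_simps:
  assumes "P \<in> Obj C" "Q \<in> Obj C" "Z \<in> Obj C" "swap_arrow C P Q u"
  shows "tail_action C P Q u Z \<in> Arr C" "Dom C (tail_action C P Q u Z) = Q \<odot> (P \<odot> Z)"
    "Cod C (tail_action C P Q u Z) = P \<odot> (Q \<odot> Z)"
  using assms by (simp_all add: tail_action_def)

lemma tail_action_nat:
  assumes "P \<in> Obj C" "Q \<in> Obj C" "swap_arrow C P Q u"
    "f \<in> Arr C" "Dom C f = Z" "Cod C f = Z'"
  shows "tail_action C P Q u Z' \<bullet> (Ident C Q \<star> (Ident C P \<star> f))
    = (Ident C P \<star> (Ident C Q \<star> f)) \<bullet> tail_action C P Q u Z"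
proof -
  have Z: "Z \<in> Obj C" "Z' \<in> Obj C"
    using assms by auto
  have 1: "arr_inv C (Assoc C Q P Z') \<bullet> (Ident C Q \<star> (Ident C P \<star> f))
      = (Ident C (Q \<odot> P) \<star> f) \<bullet> arr_inv C (Assoc C Q P Z)"
    using assms Z Assoc_nat[of "Ident C Q" "Ident C P" f Q P Z'] by (intro square_arr_inv) auto
  have 2: "Assoc C P Q Z' \<bullet> (Ident C (P \<odot> Q) \<star> f) = (Ident C P \<star> (Ident C Q \<star> f)) \<bullet> Assoc C P Q Z"
    using assms Z Assoc_nat[of "Ident C P" "Ident C Q" f P Q Z'] by auto
  have 3: "(u \<star> Ident C Z') \<bullet> (Ident C (Q \<odot> P) \<star> f) = (Ident C (P \<odot> Q) \<star> f) \<bullet> (u \<star> Ident C Z)"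
    using assms by (intro interchange) auto
  have "tail_action C P Q u Z' \<bullet> (Ident C Q \<star> (Ident C P \<star> f))
      = Assoc C P Q Z' \<bullet> (((u \<star> Ident C Z') \<bullet> (Ident C (Q \<odot> P) \<star> f)) \<bullet> arr_inv C (Assoc C Q P Z))"
    using assms Z by (simp add: tail_action_def 1)
  also have "\<dots> = (Assoc C P Q Z' \<bullet> (Ident C (P \<odot> Q) \<star> f))
      \<bullet> ((u \<star> Ident C Z) \<bullet> arr_inv C (Assoc C Q P Z))"
    unfolding 3 using assms Z by simp
  also have "\<dots> = (Ident C P \<star> (Ident C Q \<star> f)) \<bullet> tail_action C P Q u Z"
    unfolding 2 using assms Z by (simp add: tail_action_def)
  finally show ?thesis .
qed

text \<open>A single tail already determines the swap: the associators cancel, and tensoring with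
  the invertible object \<open>Z\<close> is faithful.\<close>

lemma tail_action_inj:
  assumes eq: "tail_action C P Q u Z = tail_action C P Q v Z"
    and *: "P \<in> Obj C" "Q \<in> Obj C" "Z \<in> Obj C" "swap_arrow C P Q u" "swap_arrow C P Q v"
  shows "u = v"
proof -
  have "Assoc C P Q Z \<bullet> ((u \<star> Ident C Z) \<bullet> arr_inv C (Assoc C Q P Z))
      = Assoc C P Q Z \<bullet> ((v \<star> Ident C Z) \<bullet> arr_inv C (Assoc C Q P Z))"
    using eq * by (simp add: tail_action_def)
  then have "(u \<star> Ident C Z) \<bullet> arr_inv C (Assoc C Q P Z) = (v \<star> Ident C Z) \<bullet> arr_inv C (Assoc C Q P Z)"
    by (rule Comp_left_cancel) (use * in auto)
  then have "u \<star> Ident C Z = v \<star> Ident C Z"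
    by (rule Comp_right_cancel) (use * in auto)
  then show ?thesis
    by (rule Tensor_right_faithful) (use * in auto)
qed

section \<open>Pentagon and naturality as rewriting rules\<close>

lemma pentagon_right:
  assumes "W \<in> Obj C" "X \<in> Obj C" "Y \<in> Obj C" "Z \<in> Obj C"
  shows "(Ident C W \<star> Assoc C X Y Z) \<bullet> (Assoc C W (X \<odot> Y) Z \<bullet> (Assoc C W X Y \<star> Ident C Z))
    = Assoc C W X (Y \<odot> Z) \<bullet> Assoc C (W \<odot> X) Y Z"
  using pentagon[of W X Y Z] assms by simp

lemma pentagon_split:
  assumes "W \<in> Obj C" "X \<in> Obj C" "Y \<in> Obj C" "Z \<in> Obj C"
    "k \<in> Arr C" "Cod C k = (W \<odot> (X \<odot> Y)) \<odot> Z"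
  shows "Assoc C W X (Y \<odot> Z) \<bullet> (Assoc C (W \<odot> X) Y Z \<bullet> ((arr_inv C (Assoc C W X Y) \<star> Ident C Z) \<bullet> k))
    = (Ident C W \<star> Assoc C X Y Z) \<bullet> (Assoc C W (X \<odot> Y) Z \<bullet> k)"
proof -
  have "Assoc C W X (Y \<odot> Z) \<bullet> (Assoc C (W \<odot> X) Y Z \<bullet> ((arr_inv C (Assoc C W X Y) \<star> Ident C Z) \<bullet> k))
      = (Assoc C W X (Y \<odot> Z) \<bullet> Assoc C (W \<odot> X) Y Z) \<bullet> ((arr_inv C (Assoc C W X Y) \<star> Ident C Z) \<bullet> k)"
    using assms by simp
  also have "\<dots> = (Ident C W \<star> Assoc C X Y Z) \<bullet> (Assoc C W (X \<odot> Y) Z \<bullet> k)"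
    unfolding pentagon_right[OF assms(1-4), symmetric] using assms by simp
  finally show ?thesis .
qed

lemma pentagon_middle:
  assumes "W \<in> Obj C" "X \<in> Obj C" "Y \<in> Obj C" "Z \<in> Obj C"
    "k \<in> Arr C" "Cod C k = ((W \<odot> X) \<odot> Y) \<odot> Z"
  shows "Assoc C W (X \<odot> Y) Z \<bullet> ((Assoc C W X Y \<star> Ident C Z) \<bullet> k)
    = (Ident C W \<star> arr_inv C (Assoc C X Y Z))
      \<bullet> (Assoc C W X (Y \<odot> Z) \<bullet> (Assoc C (W \<odot> X) Y Z \<bullet> k))"
proof -
  have "(Ident C W \<star> arr_inv C (Assoc C X Y Z)) \<bullet> (Assoc C W X (Y \<odot> Z) \<bullet> (Assoc C (W \<odot> X) Y Z \<bullet> k))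
     = (Ident C W \<star> arr_inv C (Assoc C X Y Z)) \<bullet> ((Assoc C W X (Y \<odot> Z) \<bullet> Assoc C (W \<odot> X) Y Z) \<bullet> k)"
    using assms by simp
  also have "\<dots> = Assoc C W (X \<odot> Y) Z \<bullet> ((Assoc C W X Y \<star> Ident C Z) \<bullet> k)"
    unfolding pentagon_right[OF assms(1-4), symmetric] using assms by simp
  finally show ?thesis
    by simp
qed

lemma pentagon_left:
  assumes "W \<in> Obj C" "X \<in> Obj C" "Y \<in> Obj C" "Z \<in> Obj C"
  shows "Assoc C (W \<odot> X) Y Z \<bullet> ((arr_inv C (Assoc C W X Y) \<star> Ident C Z) \<bullet> arr_inv C (Assoc C W (X \<odot> Y) Z))
    = arr_inv C (Assoc C W X (Y \<odot> Z)) \<bullet> (Ident C W \<star> Assoc C X Y Z)"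
proof -
  have "arr_inv C (Assoc C W X (Y \<odot> Z)) \<bullet> (Ident C W \<star> Assoc C X Y Z)
      = arr_inv C (Assoc C W X (Y \<odot> Z)) \<bullet> ((Ident C W \<star> Assoc C X Y Z)
        \<bullet> (Assoc C W (X \<odot> Y) Z \<bullet> arr_inv C (Assoc C W (X \<odot> Y) Z)))"
    using assms by simp
  also have "\<dots> = arr_inv C (Assoc C W X (Y \<odot> Z)) \<bullet> (Assoc C W X (Y \<odot> Z) \<bullet> (Assoc C (W \<odot> X) Y Z
        \<bullet> ((arr_inv C (Assoc C W X Y) \<star> Ident C Z) \<bullet> arr_inv C (Assoc C W (X \<odot> Y) Z))))"
    using assms by (subst pentagon_split) simp_all
  also have "\<dots> = Assoc C (W \<odot> X) Y Z
        \<bullet> ((arr_inv C (Assoc C W X Y) \<star> Ident C Z) \<bullet> arr_inv C (Assoc C W (X \<odot> Y) Z))"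
    using assms by simp
  finally show ?thesis
    by simp
qed

lemma Assoc_nat_Comp:
  assumes "f \<in> Arr C" "g \<in> Arr C" "h \<in> Arr C" "Cod C f = X" "Cod C g = Y" "Cod C h = Z"
    "k \<in> Arr C" "Cod C k = (Dom C f \<odot> Dom C g) \<odot> Dom C h"
  shows "Assoc C X Y Z \<bullet> (((f \<star> g) \<star> h) \<bullet> k)
    = (f \<star> (g \<star> h)) \<bullet> (Assoc C (Dom C f) (Dom C g) (Dom C h) \<bullet> k)"
proof -
  have "Assoc C X Y Z \<bullet> (((f \<star> g) \<star> h) \<bullet> k) = (Assoc C X Y Z \<bullet> ((f \<star> g) \<star> h)) \<bullet> k"
    using assms by auto
  then show ?thesis
    using assms Assoc_nat[OF assms(1-6)] by simp
qed

lemma Assoc_inv_nat: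
  assumes "f \<in> Arr C" "g \<in> Arr C" "h \<in> Arr C" "Cod C f = X" "Cod C g = Y" "Cod C h = Z"
  shows "arr_inv C (Assoc C X Y Z) \<bullet> (f \<star> (g \<star> h))
    = ((f \<star> g) \<star> h) \<bullet> arr_inv C (Assoc C (Dom C f) (Dom C g) (Dom C h))"
  using assms Assoc_nat[OF assms] by (intro square_arr_inv) auto

lemma Assoc_inv_nat_Comp:
  assumes "f \<in> Arr C" "g \<in> Arr C" "h \<in> Arr C" "Cod C f = X" "Cod C g = Y" "Cod C h = Z"
    "k \<in> Arr C" "Cod C k = Dom C f \<odot> (Dom C g \<odot> Dom C h)"
  shows "arr_inv C (Assoc C X Y Z) \<bullet> ((f \<star> (g \<star> h)) \<bullet> k)
    = ((f \<star> g) \<star> h) \<bullet> (arr_inv C (Assoc C (Dom C f) (Dom C g) (Dom C h)) \<bullet> k)"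
proof -
  have "arr_inv C (Assoc C X Y Z) \<bullet> ((f \<star> (g \<star> h)) \<bullet> k)
      = (arr_inv C (Assoc C X Y Z) \<bullet> (f \<star> (g \<star> h))) \<bullet> k"
    using assms by auto
  then show ?thesis
    using assms Assoc_inv_nat[OF assms(1-6)] by simp
qed

text \<open>Each of the three associators in \<open>half_braid\<close>, whiskered by
  \<open>Z\<close>, meets the associators of the tail in one pentagon: \<open>pentagon_split\<close>
  at the target, \<open>pentagon_middle\<close> between the swaps, \<open>pentagon_left\<close> at
  the source.\<close>

lemma tail_action_half_braid:
  assumes [simp]: "P \<in> Obj C" "P' \<in> Obj C" "Q \<in> Obj C" "Z \<in> Obj C"
    and u: "swap_arrow C P Q u" and v: "swap_arrow C P' Q v"
  shows "tail_action C (P \<odot> P') Q (half_braid C P P' Q u v) Z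
    = arr_inv C (Assoc C P P' (Q \<odot> Z)) \<bullet> ((Ident C P \<star> tail_action C P' Q v Z)
      \<bullet> (tail_action C P Q u (P' \<odot> Z) \<bullet> (Ident C Q \<star> Assoc C P P' Z)))"
    (is "?L = arr_inv C ?\<alpha> \<bullet> ?R")
proof -
  \<comment> \<open>The associator is moved to the left side because only there does it complete the
    pattern of \<open>pentagon_split\<close>.\<close>
  have "?\<alpha> \<bullet> ?L = ?R"
    using u v
    by (simp add: tail_action_def half_braid_def whisker_left whisker_right pentagon_split
        pentagon_middle pentagon_left Assoc_nat_Comp)
  then have "arr_inv C ?\<alpha> \<bullet> (?\<alpha> \<bullet> ?L) = arr_inv C ?\<alpha> \<bullet> ?R"
    by simp
  then show ?thesis
    using half_braid_swap[OF _ _ _ u v] by (simp add: tail_action_simps)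
qed

lemma tail_action_transport:
  assumes [simp]: "Q \<in> Obj C" "Z \<in> Obj C" "h \<in> Arr C" "Dom C h = P" "Cod C h = R"
    and u: "swap_arrow C P Q u"
  shows "tail_action C R Q (transport C Q h u) Z
    = (h \<star> Ident C (Q \<odot> Z)) \<bullet> (tail_action C P Q u Z \<bullet> (Ident C Q \<star> (arr_inv C h \<star> Ident C Z)))"
proof -
  have [simp]: "P \<in> Obj C" "R \<in> Obj C"
    using Dom_Cod_Obj[of h] assms(3-5) by simp_all
  show ?thesis
    using u by (simp add: tail_action_def transport_def whisker_right Assoc_nat_Comp Assoc_inv_nat)
qed

text \<open>\<open>Tensor_Ident\<close> merges two identities into
  \<open>Ident C (X \<odot> Y)\<close>, which hides the threefold tensor product from the general
  naturality rules. This rule and the next two cover the merged forms.\<close>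

lemma Assoc_inv_Ident_left_Comp:
  assumes "X \<in> Obj C" "Y \<in> Obj C" "f \<in> Arr C" "Dom C f = Z" "Cod C f = Z'"
    "k \<in> Arr C" "Cod C k = X \<odot> (Y \<odot> Z)"
  shows "(Ident C (X \<odot> Y) \<star> f) \<bullet> (arr_inv C (Assoc C X Y Z) \<bullet> k)
    = arr_inv C (Assoc C X Y Z') \<bullet> ((Ident C X \<star> (Ident C Y \<star> f)) \<bullet> k)"
  using assms Assoc_inv_nat_Comp[of "Ident C X" "Ident C Y" f X Y Z' k] by simp

lemma Assoc_Ident_left_Comp:
  assumes "X \<in> Obj C" "Y \<in> Obj C" "f \<in> Arr C" "Dom C f = Z" "Cod C f = Z'"
    "k \<in> Arr C" "Cod C k = (X \<odot> Y) \<odot> Z"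
  shows "Assoc C X Y Z' \<bullet> ((Ident C (X \<odot> Y) \<star> f) \<bullet> k)
    = (Ident C X \<star> (Ident C Y \<star> f)) \<bullet> (Assoc C X Y Z \<bullet> k)"
  using assms Assoc_nat_Comp[of "Ident C X" "Ident C Y" f X Y Z' k] by simp

lemma Assoc_inv_Ident_right_Comp:
  assumes "Y \<in> Obj C" "Z \<in> Obj C" "f \<in> Arr C" "Dom C f = X" "Cod C f = X'"
    "k \<in> Arr C" "Cod C k = X \<odot> (Y \<odot> Z)"
  shows "arr_inv C (Assoc C X' Y Z) \<bullet> ((f \<star> Ident C (Y \<odot> Z)) \<bullet> k)
    = ((f \<star> Ident C Y) \<star> Ident C Z) \<bullet> (arr_inv C (Assoc C X Y Z) \<bullet> k)"
  using assms Assoc_inv_nat_Comp[of f "Ident C Y" "Ident C Z" X' Y Z k] by simp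

lemma interchange_Comp:
  assumes "f \<in> Arr C" "g \<in> Arr C" "Dom C f = X" "Cod C f = X'" "Dom C g = Y" "Cod C g = Y'"
    "k \<in> Arr C" "Cod C k = X \<odot> Y"
  shows "(f \<star> Ident C Y') \<bullet> ((Ident C X \<star> g) \<bullet> k) = (Ident C X' \<star> g) \<bullet> ((f \<star> Ident C Y) \<bullet> k)"
proof -
  have [simp]: "X \<in> Obj C" "Y \<in> Obj C" "X' \<in> Obj C" "Y' \<in> Obj C"
    using assms by auto
  have "(f \<star> Ident C Y') \<bullet> ((Ident C X \<star> g) \<bullet> k) = ((f \<star> Ident C Y') \<bullet> (Ident C X \<star> g)) \<bullet> k"
    using assms(1-8) by simp
  then show ?thesis
    unfolding interchange[OF assms(1-6)] using assms(1-8) by simp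
qed

text \<open>Oriented so that arrows acting inside the tail travel towards the source; this gives
  composites of whiskered actions a common normal form.\<close>

lemma tail_action_nat_Comp:
  assumes "P \<in> Obj C" "Q \<in> Obj C" "swap_arrow C P Q u"
    "f \<in> Arr C" "Dom C f = Z" "Cod C f = Z'" "k \<in> Arr C" "Cod C k = Q \<odot> (P \<odot> Z)"
  shows "(Ident C P \<star> (Ident C Q \<star> f)) \<bullet> (tail_action C P Q u Z \<bullet> k)
    = tail_action C P Q u Z' \<bullet> ((Ident C Q \<star> (Ident C P \<star> f)) \<bullet> k)"
proof -
  have "Z \<in> Obj C" "Z' \<in> Obj C"
    using assms by auto
  moreover have "tail_action C P Q u Z' \<bullet> ((Ident C Q \<star> (Ident C P \<star> f)) \<bullet> k)
      = (tail_action C P Q u Z' \<bullet> (Ident C Q \<star> (Ident C P \<star> f))) \<bullet> k"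
    using assms calculation by (simp add: tail_action_simps)
  ultimately show ?thesis
    unfolding tail_action_nat[OF assms(1-6)] using assms by (simp add: tail_action_simps)
qed

lemma pentagon_inv_Comp:
  assumes "W \<in> Obj C" "X \<in> Obj C" "Y \<in> Obj C" "Z \<in> Obj C"
    "k \<in> Arr C" "Cod C k = W \<odot> (X \<odot> (Y \<odot> Z))"
  shows "(Assoc C W X Y \<star> Ident C Z) \<bullet> (arr_inv C (Assoc C (W \<odot> X) Y Z)
      \<bullet> (arr_inv C (Assoc C W X (Y \<odot> Z)) \<bullet> k))
    = arr_inv C (Assoc C W (X \<odot> Y) Z) \<bullet> ((Ident C W \<star> arr_inv C (Assoc C X Y Z)) \<bullet> k)"
proof -
  have 1: "arr_inv C (Assoc C (W \<odot> X) Y Z) \<bullet> arr_inv C (Assoc C W X (Y \<odot> Z))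
      = (arr_inv C (Assoc C W X Y) \<star> Ident C Z) \<bullet> (arr_inv C (Assoc C W (X \<odot> Y) Z)
        \<bullet> (Ident C W \<star> arr_inv C (Assoc C X Y Z)))"
    using arg_cong[OF pentagon_right[of W X Y Z], of "arr_inv C"] assms by simp
  have "arr_inv C (Assoc C (W \<odot> X) Y Z) \<bullet> (arr_inv C (Assoc C W X (Y \<odot> Z)) \<bullet> k)
      = (arr_inv C (Assoc C (W \<odot> X) Y Z) \<bullet> arr_inv C (Assoc C W X (Y \<odot> Z))) \<bullet> k"
    using assms by simp
  then show ?thesis
    unfolding 1 using assms by simp
qed

text \<open>On a tail both bracketings let \<open>u\<close>, \<open>v\<close> and \<open>w\<close>
  act one after the other. The associators left over differ by one pentagon at the source,
  \<open>A\<close>, and one at the target, \<open>pentagon_inv_Comp\<close>.\<close>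

lemma half_braid_assoc:
  assumes [simp]: "P \<in> Obj C" "P' \<in> Obj C" "P'' \<in> Obj C" "Q \<in> Obj C"
    and u: "swap_arrow C P Q u" and v: "swap_arrow C P' Q v" and w: "swap_arrow C P'' Q w"
  shows "transport C Q (Assoc C P P' P'')
      (half_braid C (P \<odot> P') P'' Q (half_braid C P P' Q u v) w)
    = half_braid C P (P' \<odot> P'') Q u (half_braid C P' P'' Q v w)"
    (is "transport C Q ?\<alpha> ?l = ?r")
proof -
  note uv = half_braid_swap[OF _ _ _ u v] and vw = half_braid_swap[OF _ _ _ v w]
  note l = half_braid_swap[OF _ _ _ uv w] and r = half_braid_swap[OF _ _ _ u vw]
  have t: "swap_arrow C (P \<odot> (P' \<odot> P'')) Q (transport C Q ?\<alpha> ?l)"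
    using l by (intro transport_swap) simp_all
  let ?Z = "Tensor_unit C"
  have A: "(Ident C Q \<star> Assoc C P P' (P'' \<odot> ?Z)) \<bullet> ((Ident C Q \<star> Assoc C (P \<odot> P') P'' ?Z)
        \<bullet> (Ident C Q \<star> (arr_inv C ?\<alpha> \<star> Ident C ?Z)))
      = (Ident C Q \<star> (Ident C P \<star> Assoc C P' P'' ?Z)) \<bullet> (Ident C Q \<star> Assoc C P (P' \<odot> P'') ?Z)"
    using pentagon_split[of P P' P'' ?Z "Ident C ((P \<odot> (P' \<odot> P'')) \<odot> ?Z)"]
    by (simp flip: whisker_left)
  have "tail_action C (P \<odot> (P' \<odot> P'')) Q (transport C Q ?\<alpha> ?l) ?Z
      = tail_action C (P \<odot> (P' \<odot> P'')) Q ?r ?Z"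
    using u v w uv vw l r
    by (simp add: tail_action_transport[where P = "P \<odot> P' \<odot> P''"] tail_action_half_braid A whisker_left
       Assoc_inv_Ident_left_Comp tail_action_nat_Comp tail_action_simps pentagon_inv_Comp)
  then show ?thesis
    by (rule tail_action_inj) (use t r in auto)
qed

lemma tail_action_opposite:
  assumes "P \<in> Obj C" "Q \<in> Obj C" "Z \<in> Obj C" "swap_arrow C P Q u"
  shows "tail_action (opposite C) Q P u Z = tail_action C P Q u Z"
  using assms by (simp add: tail_action_def)

lemma half_braid_opposite_swap:
  assumes "P \<in> Obj C" "Q \<in> Obj C" "Q' \<in> Obj C" "swap_arrow C P Q u" "swap_arrow C P Q' w"
  shows "swap_arrow C P (Q \<odot> Q') (half_braid (opposite C) Q Q' P u w)"
proof -
  interpret op: gr_category "opposite C"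
    by (rule opposite_gr_category)
  show ?thesis
    using op.half_braid_swap[of Q Q' P u w] assms by simp
qed

text \<open>\<open>tail_action\<close> is self-dual up to exchanging \<open>P\<close> and
  \<open>Q\<close>, so this is \<open>tail_action_half_braid\<close> with its composite read
  backwards: here \<open>w\<close> acts before \<open>u\<close>.\<close>

lemma tail_action_half_braid_opposite:
  assumes [simp]: "P \<in> Obj C" "Q \<in> Obj C" "Q' \<in> Obj C" "Z \<in> Obj C"
    and u: "swap_arrow C P Q u" and w: "swap_arrow C P Q' w"
  shows "tail_action C P (Q \<odot> Q') (half_braid (opposite C) Q Q' P u w) Z
    = (Ident C P \<star> arr_inv C (Assoc C Q Q' Z)) \<bullet> (tail_action C P Q u (Q' \<odot> Z)
      \<bullet> ((Ident C Q \<star> tail_action C P Q' w Z) \<bullet> Assoc C Q Q' (P \<odot> Z)))"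
proof -
  interpret op: gr_category "opposite C"
    by (rule opposite_gr_category)
  show ?thesis
    using op.tail_action_half_braid[of Q Q' P Z u w] u w half_braid_opposite_swap[OF _ _ _ u w]
    by (simp add: tail_action_opposite tail_action_simps)
qed

text \<open>On a tail the swaps act in the order \<open>c\<close>, \<open>d\<close>,
  \<open>a\<close>, \<open>b\<close> on the left and \<open>c\<close>, \<open>a\<close>,
  \<open>d\<close>, \<open>b\<close> on the right. Exchanging \<open>a\<close> and \<open>d\<close>
  is naturality of the action of \<open>a\<close> in its tail, applied to the action of
  \<open>d\<close>.\<close>

lemma half_braid_interchange:
  assumes [simp]: "P \<in> Obj C" "P' \<in> Obj C" "Q \<in> Obj C" "Q' \<in> Obj C"
    and a: "swap_arrow C P Q a" and b: "swap_arrow C P' Q b"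
    and c: "swap_arrow C P Q' c" and d: "swap_arrow C P' Q' d"
  shows "half_braid (opposite C) Q Q' (P \<odot> P') (half_braid C P P' Q a b) (half_braid C P P' Q' c d)
    = half_braid C P P' (Q \<odot> Q') (half_braid (opposite C) Q Q' P a c) (half_braid (opposite C) Q Q' P' b d)"
    (is "?l = ?r")
proof -
  note ab = half_braid_swap[OF _ _ _ a b] and cd = half_braid_swap[OF _ _ _ c d]
    and ac = half_braid_opposite_swap[OF _ _ _ a c] and bd = half_braid_opposite_swap[OF _ _ _ b d]
  note l = half_braid_opposite_swap[OF _ _ _ ab cd] and r = half_braid_swap[OF _ _ _ ac bd]
  let ?Z = "Tensor_unit C"
  have A: "Assoc C Q Q' (P \<odot> (P' \<odot> ?Z)) \<bullet> (Ident C (Q \<odot> Q') \<star> Assoc C P P' ?Z)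
      = (Ident C Q \<star> (Ident C Q' \<star> Assoc C P P' ?Z)) \<bullet> Assoc C Q Q' ((P \<odot> P') \<odot> ?Z)"
    using Assoc_nat[of "Ident C Q" "Ident C Q'" "Assoc C P P' ?Z" Q Q' "P \<odot> (P' \<odot> ?Z)"] by simp
  have "tail_action C (P \<odot> P') (Q \<odot> Q') ?l ?Z = tail_action C (P \<odot> P') (Q \<odot> Q') ?r ?Z"
    using a b c d ab cd ac bd l r
    by (simp add: tail_action_half_braid tail_action_half_braid_opposite A whisker_left
       Assoc_inv_nat_Comp tail_action_nat_Comp tail_action_simps)
  then show ?thesis
    by (rule tail_action_inj) (use l r in auto)
qed

section \<open>Compatibility of products with transport\<close>

lemma transport_Comp:
  assumes "h \<in> Arr C" "k \<in> Arr C" "Dom C k = Cod C h" "Q \<in> Obj C" "swap_arrow C (Dom C h) Q u"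
  shows "transport C Q k (transport C Q h u) = transport C Q (k \<bullet> h) u"
  using assms by (simp add: transport_def whisker_left whisker_right)

text \<open>A transport of one factor is pulled out of the product, so that nested transports can be
  composed into one.\<close>

lemma half_braid_transport:
  assumes [simp]: "P \<in> Obj C" "P' \<in> Obj C" "Q \<in> Obj C" "h \<in> Arr C" "Cod C h = R"
    and "Dom C h = P" and u: "swap_arrow C P Q u" and v: "swap_arrow C P' Q v"
  shows "half_braid C R P' Q (transport C Q h u) v
    = transport C Q (h \<star> Ident C P') (half_braid C P P' Q u v)"
proof -
  have [simp]: "R \<in> Obj C"
    using Dom_Cod_Obj[of h] by simp
  show ?thesis
    using assms(6) u v
    by (simp add: half_braid_def transport_def whisker_right whisker_left Assoc_nat_Comp
        Assoc_inv_nat Assoc_inv_Ident_right_Comp flip: interchange_Comp[of h v])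
qed

lemma half_braid_transport_right:
  assumes [simp]: "P \<in> Obj C" "P' \<in> Obj C" "Q \<in> Obj C" "h \<in> Arr C" "Cod C h = R"
    and "Dom C h = P'" and u: "swap_arrow C P Q u" and v: "swap_arrow C P' Q v"
  shows "half_braid C P R Q u (transport C Q h v)
    = transport C Q (Ident C P \<star> h) (half_braid C P P' Q u v)"
proof -
  have [simp]: "R \<in> Obj C"
    using Dom_Cod_Obj[of h] by simp
  show ?thesis
    using assms(6) u v
    by (simp add: half_braid_def transport_def whisker_right whisker_left Assoc_inv_nat_Comp
        Assoc_inv_nat Assoc_Ident_left_Comp interchange_Comp[of u "arr_inv C h"])
qed

end

context central_gr_category
begin

lemma transport_right_mult:
  assumes "a \<in> carrier (Aut_unit C)" "P \<in> Obj C" "Q \<in> Obj C" "swap_arrow C P Q u"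
  shows "transport C Q (right_mult C P a) u = u"
proof -
  have "transport C Q (right_mult C P a) u
      = (right_mult C (P \<odot> Q) a \<bullet> u) \<bullet> arr_inv C (Ident C Q \<star> right_mult C P a)"
    using assms by (simp add: transport_def right_mult_Tensor)
  also have "\<dots> = (u \<bullet> right_mult C (Q \<odot> P) a) \<bullet> arr_inv C (right_mult C (Q \<odot> P) a)"
    using assms right_mult_nat[of a u "Q \<odot> P" "P \<odot> Q"] by (simp add: right_mult_Tensor_left)
  also have "\<dots> = u"
    using assms by simp
  finally show ?thesis .
qed

lemma transport_parallel:
  assumes h: "h \<in> Arr C" and k: "k \<in> Arr C" "Dom C k = Dom C h" "Cod C k = Cod C h"
    and Q: "Q \<in> Obj C" and u: "swap_arrow C (Dom C h) Q u"
  shows "transport C Q h u = transport C Q k u"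
proof -
  obtain a where a: "a \<in> carrier (Aut_unit C)" "right_mult C (Dom C h) a = arr_inv C k \<bullet> h"
    using right_mult_surj[of "arr_inv C k \<bullet> h" "Dom C h"] h k by auto
  have "transport C Q h u = transport C Q (k \<bullet> (arr_inv C k \<bullet> h)) u"
    using h k by simp
  also have "\<dots> = transport C Q k (transport C Q (right_mult C (Dom C h) a) u)"
    using h k Q u a by (subst transport_Comp) auto
  also have "\<dots> = transport C Q k u"
    using a Q u h by (subst transport_right_mult) auto
  finally show ?thesis .
qed

end

context gr_category
begin

text \<open>Both factors of this product share the object \<open>P\<close>. Between them
  \<open>h\<close> from the transport of \<open>w\<close> meets the inverse of \<open>h\<close> from
  that of \<open>u\<close>; this pair cancels in \<open>A\<close>, and only the outer pair
  remains.\<close>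

lemma half_braid_opposite_transport:
  assumes [simp]: "P \<in> Obj C" "Q \<in> Obj C" "Q' \<in> Obj C" "h \<in> Arr C" "Cod C h = R"
    and "Dom C h = P" and u: "swap_arrow C P Q u" and w: "swap_arrow C P Q' w"
  shows "half_braid (opposite C) Q Q' R (transport C Q h u) (transport C Q' h w)
    = transport C (Q \<odot> Q') h (half_braid (opposite C) Q Q' P u w)"
proof -
  have [simp]: "R \<in> Obj C"
    using Dom_Cod_Obj[of h] by simp
  have A: "((Ident C Q \<star> arr_inv C h) \<star> Ident C Q') \<bullet> (((Ident C Q \<star> h) \<star> Ident C Q') \<bullet> k) = k"
    if "k \<in> Arr C" "Cod C k = (Q \<odot> P) \<odot> Q'" for k
    using assms(6) that arr_inv_whisker_cancel(1)[of "Ident C Q \<star> h" Q' k] by simp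
  have B: "Assoc C Q Q' P \<bullet> (Ident C (Q \<odot> Q') \<star> arr_inv C h)
      = (Ident C Q \<star> (Ident C Q' \<star> arr_inv C h)) \<bullet> Assoc C Q Q' R"
    using assms(6) Assoc_nat[of "Ident C Q" "Ident C Q'" "arr_inv C h" Q Q' P] by simp
  show ?thesis
    using assms(6) u w
    by (simp add: half_braid_def transport_def whisker_right whisker_left Assoc_nat_Comp
        Assoc_inv_nat_Comp A B)
qed

text \<open>Changes of the first and of the second object act on different tensor factors, so they
  commute by bifunctoriality.\<close>

lemma transport_opposite_commute:
  assumes h: "h \<in> Arr C" "Dom C h = P" "Cod C h = R" and k: "k \<in> Arr C" "Dom C k = S" "Cod C k = Q"
    and u: "swap_arrow C P Q u"
  shows "transport (opposite C) R k (transport C Q h u) = transport C S h (transport (opposite C) P k u)"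
proof -
  have [simp]: "P \<in> Obj C" "Q \<in> Obj C" "R \<in> Obj C" "S \<in> Obj C"
    using h k by auto
  have A: "(Ident C Q \<star> arr_inv C h) \<bullet> (k \<star> Ident C R) = (k \<star> Ident C P) \<bullet> (Ident C S \<star> arr_inv C h)"
    using h k by (intro interchange[symmetric]) auto
  show ?thesis
    using h k u by (simp add: transport_def A interchange_Comp[of h "arr_inv C k"])
qed

section \<open>Scalars in transports and products\<close>

lemma right_mult_left_Comp:
  assumes "a \<in> carrier (Aut_unit C)" "f \<in> Arr C" "Dom C f = X" "k \<in> Arr C" "Cod C k = X"
  shows "f \<bullet> (right_mult C X a \<bullet> k) = right_mult C (Cod C f) a \<bullet> (f \<bullet> k)"
proof -
  have [simp]: "X \<in> Obj C"
    using assms by auto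
  have "f \<bullet> (right_mult C X a \<bullet> k) = (f \<bullet> right_mult C X a) \<bullet> k"
    using assms by simp
  also have "f \<bullet> right_mult C X a = right_mult C (Cod C f) a \<bullet> f"
    using assms right_mult_nat[of a f X "Cod C f"] by simp
  finally show ?thesis
    using assms by simp
qed

lemma transport_scalar:
  assumes "a \<in> carrier (Aut_unit C)" "h \<in> Arr C" "Dom C h = P" "Cod C h = R" "Q \<in> Obj C"
    "swap_arrow C P Q u"
  shows "transport C Q h (right_mult C (P \<odot> Q) a \<bullet> u)
    = right_mult C (R \<odot> Q) a \<bullet> transport C Q h u"
proof -
  have "P \<in> Obj C" "R \<in> Obj C"
    using assms by auto
  then show ?thesis
    using assms by (simp add: transport_def right_mult_left_Comp)
qed

end

context central_gr_category
begin

text \<open>All scalars are collected at the target. The one on \<open>u\<close> is whiskered on the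
  right only; the one on \<open>v\<close> stands under \<open>P\<close>, and there
  \<open>right_mult_Tensor_left\<close>, hence the trivial module structure, is used.\<close>

lemma half_braid_scalar:
  assumes "a \<in> carrier (Aut_unit C)" "P \<in> Obj C" "P' \<in> Obj C" "Q \<in> Obj C"
    "swap_arrow C P Q u" "swap_arrow C P' Q v"
  shows "half_braid C P P' Q (right_mult C (P \<odot> Q) a \<bullet> u) v
      = right_mult C (P \<odot> P' \<odot> Q) a \<bullet> half_braid C P P' Q u v"
    "half_braid C P P' Q u (right_mult C (P' \<odot> Q) a \<bullet> v)
      = right_mult C (P \<odot> P' \<odot> Q) a \<bullet> half_braid C P P' Q u v"
proof -
  show "half_braid C P P' Q (right_mult C (P \<odot> Q) a \<bullet> u) v
      = right_mult C (P \<odot> P' \<odot> Q) a \<bullet> half_braid C P P' Q u v"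
    using assms by (simp add: half_braid_def whisker_right)
      (simp add: right_mult_Tensor right_mult_left_Comp)
  show "half_braid C P P' Q u (right_mult C (P' \<odot> Q) a \<bullet> v)
      = right_mult C (P \<odot> P' \<odot> Q) a \<bullet> half_braid C P P' Q u v"
    using assms by (simp add: half_braid_def whisker_left)
      (simp add: right_mult_Tensor_left right_mult_left_Comp[where f = "arr_inv C (Assoc C P P' Q)"])
qed

text \<open>
  Associativity holds for every choice of arrows \<open>e\<close>, \<open>e'\<close>, \<open>f\<close>, \<open>f'\<close>: they need not satisfy a
  cocycle condition, because transports along parallel arrows agree.
\<close>

lemma transport_half_braid_assoc:
  assumes [simp]: "P \<in> Obj C" "P' \<in> Obj C" "P'' \<in> Obj C" "Q \<in> Obj C"
    and u: "swap_arrow C P Q u" and v: "swap_arrow C P' Q v" and w: "swap_arrow C P'' Q w"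
    and e: "e \<in> Arr C" "Dom C e = P \<odot> P'" "Cod C e = R"
    and e': "e' \<in> Arr C" "Dom C e' = R \<odot> P''" "Cod C e' = S"
    and f: "f \<in> Arr C" "Dom C f = P' \<odot> P''" "Cod C f = R'"
    and f': "f' \<in> Arr C" "Dom C f' = P \<odot> R'" "Cod C f' = S"
  shows "transport C Q e' (half_braid C R P'' Q (transport C Q e (half_braid C P P' Q u v)) w)
    = transport C Q f' (half_braid C P R' Q u (transport C Q f (half_braid C P' P'' Q v w)))"
proof -
  have [simp]: "R \<in> Obj C" "R' \<in> Obj C" "S \<in> Obj C"
    using e f e' by auto
  note uv = half_braid_swap[OF _ _ _ u v] and vw = half_braid_swap[OF _ _ _ v w]
  note l = half_braid_swap[OF _ _ _ uv w] and r = half_braid_swap[OF _ _ _ u vw]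
  let ?l = "half_braid C (P \<odot> P') P'' Q (half_braid C P P' Q u v) w"
  have "transport C Q e' (half_braid C R P'' Q (transport C Q e (half_braid C P P' Q u v)) w)
      = transport C Q (e' \<bullet> (e \<star> Ident C P'')) ?l"
    using e e' uv w l by (simp add: half_braid_transport[where P = "P \<odot> P'"] transport_Comp)
  also have "\<dots> = transport C Q (f' \<bullet> ((Ident C P \<star> f) \<bullet> Assoc C P P' P'')) ?l"
    using e e' f f' l by (intro transport_parallel) auto
  also have "\<dots> = transport C Q f' (transport C Q (Ident C P \<star> f) (transport C Q (Assoc C P P' P'') ?l))"
    using f f' l transport_swap[of "Assoc C P P' P''" Q ?l] by (simp add: transport_Comp)
  also have "\<dots> = transport C Q f' (half_braid C P R' Q u (transport C Q f (half_braid C P' P'' Q v w)))"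
    using f f' u v w vw by (simp add: half_braid_assoc half_braid_transport_right[where P' = "P' \<odot> P''"])
  finally show ?thesis .
qed

end

section \<open>The contracted product of torsors\<close>

context right_torsor
begin

lemma act_free:
  assumes "t \<in> T" "a \<in> carrier A" "b \<in> carrier A" "act t a = act t b"
  shows "a = b"
  using simply_transitive[OF assms(1) act_closed[OF assms(1,2)]] assms by metis

lemma act_transitive:
  assumes "s \<in> T" "t \<in> T"
  obtains a where "a \<in> carrier A" "act s a = t"
  using simply_transitive[OF assms] by blast

end

locale torsor_pair = comm_group A + E: right_torsor A E actE + F: right_torsor A F actF
  for A :: "('a, 'z) monoid_scheme" (structure) and E :: "'e set" and actE and F :: "'f set" and actF
begin

abbreviation "rel \<equiv> contracted_rel A E actE F actF"
abbreviation "cls u v \<equiv> rel `` {(u, v)}"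

lemma rel_iff:
  "((u, v), (u', v')) \<in> rel \<longleftrightarrow>
    u' \<in> E \<and> v \<in> F \<and> (\<exists>a \<in> carrier A. u = actE u' a \<and> v' = actF v a)"
  by (auto simp: contracted_rel_def)

lemma equiv_rel: "equiv (E \<times> F) rel"
proof (rule equivI)
  show "rel \<subseteq> (E \<times> F) \<times> (E \<times> F)"
    by (auto simp: contracted_rel_def E.act_closed F.act_closed)
  show "refl_on (E \<times> F) rel"
    by (auto simp: refl_on_def rel_iff E.act_one F.act_one intro!: bexI[of _ \<one>])
  show "sym rel"
  proof (rule symI, clarify)
    fix u v u' v' assume "((u, v), (u', v')) \<in> rel"
    then obtain a where a: "u' \<in> E" "v \<in> F" "a \<in> carrier A" "u = actE u' a" "v' = actF v a"
      by (auto simp: rel_iff)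
    then have "actE u (inv a) = u'" "actF v' (inv a) = v"
      by (simp_all add: E.act_one F.act_one flip: E.act_mult F.act_mult)
    then show "((u', v'), (u, v)) \<in> rel"
      using a by (auto simp: rel_iff E.act_closed F.act_closed intro!: bexI[of _ "inv a"])
  qed
  show "trans rel"
  proof (rule transI, clarify)
    fix u v u' v' u'' v''
    assume "((u, v), (u', v')) \<in> rel" "((u', v'), (u'', v'')) \<in> rel"
    then obtain a b where "u'' \<in> E" "v \<in> F" "a \<in> carrier A" "u = actE u' a" "v' = actF v a"
      "b \<in> carrier A" "u' = actE u'' b" "v'' = actF v' b"
      by (auto simp: rel_iff)
    \<comment> \<open>Commutativity of \<open>A\<close> enters: the first components are related by
      \<open>b \<otimes> a\<close>, the second ones by \<open>a \<otimes> b\<close>.\<close>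
    moreover from this have "actF v (b \<otimes> a) = v''"
      by (subst m_comm) (simp_all add: F.act_mult)
    ultimately show "((u, v), (u'', v'')) \<in> rel"
      by (auto simp: rel_iff E.act_mult intro!: bexI[of _ "b \<otimes> a"])
  qed
qed

lemma cls_eq_iff:
  assumes "u \<in> E" "v \<in> F" "u' \<in> E" "v' \<in> F"
  shows "cls u v = cls u' v' \<longleftrightarrow> ((u, v), (u', v')) \<in> rel"
  using eq_equiv_class_iff[OF equiv_rel] assms by auto

lemma cls_act_left:
  assumes "u \<in> E" "v \<in> F" "a \<in> carrier A"
  shows "cls (actE u a) v = cls u (actF v a)"
  using assms by (auto simp: cls_eq_iff E.act_closed F.act_closed rel_iff)

lemma contracted_productE:
  assumes "K \<in> contracted_product A E actE F actF"
  obtains u v where "u \<in> E" "v \<in> F" "K = cls u v"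
  using assms by (auto simp: contracted_product_def quotient_def)

lemma cls_in: "u \<in> E \<Longrightarrow> v \<in> F \<Longrightarrow> cls u v \<in> contracted_product A E actE F actF"
  by (auto simp: contracted_product_def quotient_def)

lemma cls_memE:
  assumes "(u', v') \<in> cls u v"
  obtains a where "u' \<in> E" "v \<in> F" "a \<in> carrier A" "u = actE u' a" "v' = actF v a"
  using assms by (auto simp: rel_iff)

lemma cls_self: "u \<in> E \<Longrightarrow> v \<in> F \<Longrightarrow> (u, v) \<in> cls u v"
  using equiv_class_self[OF equiv_rel] by auto

text \<open>Every representative contributes the same class to the union in
  \<open>contracted_act\<close>, since the scalar \<open>b\<close> relating two representatives
  commutes with \<open>a\<close>.\<close>

lemma contracted_act_cls:
  assumes u: "u \<in> E" and v: "v \<in> F" and a: "a \<in> carrier A"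
  shows "contracted_act A E actE F actF (cls u v) a = cls u (actF v a)"
proof -
  have "cls u' (actF v' a) = cls u (actF v a)" if m: "(u', v') \<in> cls u v" for u' v'
    using m
  proof (rule cls_memE)
    fix b assume b: "u' \<in> E" "b \<in> carrier A" "u = actE u' b" "v' = actF v b"
    then have "actF v' a = actF (actF v a) b"
      using v a by (simp add: m_comm[of a b] flip: F.act_mult)
    then show ?thesis
      using b v a by (simp add: cls_act_left F.act_closed)
  qed
  then have "\<Union>((\<lambda>(u', v'). cls u' (actF v' a)) ` cls u v) = cls u (actF v a)"
    using cls_self[OF u v] by fastforce
  then show ?thesis
    by (simp add: contracted_act_def)
qed

lemma contracted_torsor:
  "right_torsor A (contracted_product A E actE F actF) (contracted_act A E actE F actF)"
proof
  fix s t assume "s \<in> contracted_product A E actE F actF" "t \<in> contracted_product A E actE F actF"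
  then obtain u v u' v' where s: "u \<in> E" "v \<in> F" "s = cls u v" and t: "u' \<in> E" "v' \<in> F" "t = cls u' v'"
    by (metis contracted_productE)
  \<comment> \<open>Both classes are given the same first component \<open>u\<close>, which reduces
    the question to simple transitivity on \<open>F\<close>.\<close>
  obtain b where b: "b \<in> carrier A" "actE u b = u'"
    using E.act_transitive[OF s(1) t(1)] .
  then have t': "t = cls u (actF v' b)"
    using s t cls_act_left by blast
  obtain a where a: "a \<in> carrier A" "actF v a = actF v' b"
    using F.act_transitive[OF s(2) F.act_closed[OF t(2) b(1)]] .
  show "\<exists>!a. a \<in> carrier A \<and> contracted_act A E actE F actF s a = t"
  proof (rule ex1I[of _ a])
    show "a \<in> carrier A \<and> contracted_act A E actE F actF s a = t"
      using a s t' by (simp add: contracted_act_cls)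
    fix a' assume "a' \<in> carrier A \<and> contracted_act A E actE F actF s a' = t"
    then have a': "a' \<in> carrier A" "contracted_act A E actE F actF s a' = t"
      by auto
    then have "cls u (actF v a') = cls u (actF v a)"
      using a s t' contracted_act_cls[OF s(1,2) a'(1)] by simp
    then have "((u, actF v a'), (u, actF v a)) \<in> rel"
      using a'(1) a(1) s(1,2) by (subst (asm) cls_eq_iff) (auto simp: F.act_closed)
    then obtain d where d: "d \<in> carrier A" "u = actE u d" "actF v a = actF (actF v a') d"
      by (auto simp: rel_iff)
    \<comment> \<open>\<open>d\<close> fixes \<open>u\<close>, and the action on \<open>E\<close> is
      free.\<close>
    then have "d = \<one>"
      using E.act_free[of u d \<one>] s by (simp add: E.act_one)
    then show "a' = a"
      using d a a' s F.act_free[of v a a'] by (simp add: F.act_one F.act_closed)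
  qed
next
  show "contracted_product A E actE F actF \<noteq> {}"
    using E.nonempty F.nonempty cls_in by blast
qed (auto elim!: contracted_productE simp: contracted_act_cls cls_in F.act_closed F.act_one F.act_mult)

text \<open>Equivariance in each variable separately makes \<open>p\<close> constant on the classes,
  because moving a scalar from one variable to the other leaves the value unchanged. Equivariance of
  the induced map is \<open>p2\<close>.\<close>

lemma induces_torsor_morphismI:
  assumes G: "right_torsor A G actG"
    and p: "\<And>u v. \<lbrakk>u \<in> E; v \<in> F\<rbrakk> \<Longrightarrow> p u v \<in> G"
    and p1: "\<And>u v a. \<lbrakk>u \<in> E; v \<in> F; a \<in> carrier A\<rbrakk> \<Longrightarrow> p (actE u a) v = actG (p u v) a"
    and p2: "\<And>u v a. \<lbrakk>u \<in> E; v \<in> F; a \<in> carrier A\<rbrakk> \<Longrightarrow> p u (actF v a) = actG (p u v) a"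
  shows "induces_torsor_morphism A E actE F actF G actG p"
proof -
  define \<phi> where "\<phi> K = the_elem ((\<lambda>(u, v). p u v) ` K)" for K
  have \<phi>: "\<phi> (cls u v) = p u v" if uv: "u \<in> E" "v \<in> F" for u v
  proof -
    have "p u' v' = p u v" if "(u', v') \<in> cls u v" for u' v'
      using that by (rule cls_memE) (use p1 p2 in auto)
    then have "(\<lambda>(u, v). p u v) ` cls u v = (\<lambda>_. p u v) ` cls u v"
      by (intro image_cong refl) (simp add: case_prod_beta)
    also have "\<dots> = {p u v}"
      using cls_self[OF uv] by (rule image_constant)
    finally show ?thesis
      by (simp add: \<phi>_def)
  qed
  have "torsor_morphism A (contracted_product A E actE F actF) (contracted_act A E actE F actF) G actG \<phi>"
    unfolding torsor_morphism_def
    by (auto simp: G contracted_torsor \<phi> p p2 contracted_act_cls F.act_closed elim!: contracted_productE)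
  then show ?thesis
    using \<phi> by (auto simp: induces_torsor_morphism_def)
qed

end

section \<open>The commutator\<close>

text \<open>\<open>opposite (opposite C)\<close> and \<open>C\<close> are different records: the
  constraints are inverted twice, which gives them back only at objects.\<close>

lemma half_braid_opposite_opposite:
  assumes "gr_category C" "P \<in> Obj C" "P' \<in> Obj C" "Q \<in> Obj C"
    "u \<in> Arr C" "v \<in> Arr C" "Dom C u = Q \<odot>\<^bsub>C\<^esub> P" "Cod C u = P \<odot>\<^bsub>C\<^esub> Q"
    "Dom C v = Q \<odot>\<^bsub>C\<^esub> P'" "Cod C v = P' \<odot>\<^bsub>C\<^esub> Q"
  shows "half_braid (opposite (opposite C)) P P' Q u v = half_braid C P P' Q u v"
proof -
  interpret gr_category C
    by (rule assms)
  show ?thesis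
    using assms by (simp add: half_braid_def)
qed

locale gr_commutator = central_gr_category C + B: comm_group "pi0 C"
  for C :: "('o, 'm, 'z) moncat_scheme" (structure) +
  fixes X :: "'o set \<Rightarrow> 'o" and c :: "'o set \<Rightarrow> 'o set \<Rightarrow> 'm"
  assumes X_mem: "x \<in> carrier (pi0 C) \<Longrightarrow> X x \<in> x"
    and c_hom: "\<lbrakk>x \<in> carrier (pi0 C); y \<in> carrier (pi0 C)\<rbrakk>
      \<Longrightarrow> c x y \<in> homset C (X x \<odot> X y) (X (x \<otimes>\<^bsub>pi0 C\<^esub> y))"
begin

sublocale op: gr_category "opposite C"
  by (rule opposite_gr_category)

lemma X_Obj [simp]: "x \<in> carrier (pi0 C) \<Longrightarrow> X x \<in> Obj C"
  using X_mem[of x] by (auto simp: pi0_def iso_class_def)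

lemma c_simps [simp]:
  assumes "x \<in> carrier (pi0 C)" "y \<in> carrier (pi0 C)"
  shows "c x y \<in> Arr C" "Dom C (c x y) = X x \<odot> X y" "Cod C (c x y) = X (x \<otimes>\<^bsub>pi0 C\<^esub> y)"
  using c_hom[OF assms] by (auto simp: homset_def)

lemma fibre_iff: "u \<in> commutator_fibre C X x y \<longleftrightarrow> swap_arrow C (X x) (X y) u"
  using all_arrows_iso by (auto simp: commutator_fibre_def homset_def)

text \<open>The action is defined at the source of a swap; naturality moves it to the target, where
  \<open>half_braid_scalar\<close> and \<open>transport_scalar\<close> collect scalars.\<close>

lemma act_eq:
  assumes "x \<in> carrier (pi0 C)" "y \<in> carrier (pi0 C)" "u \<in> commutator_fibre C X x y"
    "a \<in> carrier (Aut_unit C)"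
  shows "commutator_act C X x y u a = right_mult C (X x \<odot> X y) a \<bullet> u"
  using assms right_mult_nat[of a u] by (auto simp: commutator_act_def fibre_iff)

lemma add1_eq:
  assumes "x \<in> carrier (pi0 C)" "x' \<in> carrier (pi0 C)" "y \<in> carrier (pi0 C)"
    "u \<in> commutator_fibre C X x y" "v \<in> commutator_fibre C X x' y"
  shows "commutator_add1 C X c x x' y u v
    = transport C (X y) (c x x') (half_braid C (X x) (X x') (X y) u v)"
  using assms by (simp add: commutator_add1_def transport_def half_braid_def fibre_iff)

text \<open>In the opposite category it is the inverse of \<open>c y y'\<close> that leads from
  \<open>X y \<odot> X y'\<close> to the chosen object of the product, so it takes the place that
  \<open>c\<close> has in the first law.\<close>

lemma add2_eq:
  assumes "x \<in> carrier (pi0 C)" "y \<in> carrier (pi0 C)" "y' \<in> carrier (pi0 C)"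
    "u \<in> commutator_fibre C X x y" "v \<in> commutator_fibre C X x y'"
  shows "commutator_add2 C X c x y y' u v
    = transport (opposite C) (X x) (arr_inv C (c y y')) (half_braid (opposite C) (X y) (X y') (X x) u v)"
  using assms by (simp add: commutator_add2_def transport_def half_braid_def fibre_iff)

lemma add1_closed:
  assumes "x \<in> carrier (pi0 C)" "x' \<in> carrier (pi0 C)" "y \<in> carrier (pi0 C)"
    "u \<in> commutator_fibre C X x y" "v \<in> commutator_fibre C X x' y"
  shows "commutator_add1 C X c x x' y u v \<in> commutator_fibre C X (x \<otimes>\<^bsub>pi0 C\<^esub> x') y"
  unfolding add1_eq[OF assms] fibre_iff
  using assms half_braid_swap[of "X x" "X x'" "X y" u v]
  by (intro transport_swap) (auto simp: fibre_iff)

lemma transport_opposite_swap: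
  assumes "h \<in> Arr C" "P \<in> Obj C" "swap_arrow C P (Cod C h) u" "Dom C h = R"
  shows "swap_arrow C P R (transport (opposite C) P h u)"
  using op.transport_swap[of h P u R] assms by simp

lemma add2_closed:
  assumes "x \<in> carrier (pi0 C)" "y \<in> carrier (pi0 C)" "y' \<in> carrier (pi0 C)"
    "u \<in> commutator_fibre C X x y" "v \<in> commutator_fibre C X x y'"
  shows "commutator_add2 C X c x y y' u v \<in> commutator_fibre C X x (y \<otimes>\<^bsub>pi0 C\<^esub> y')"
  unfolding add2_eq[OF assms] fibre_iff
  using assms half_braid_opposite_swap[of "X x" "X y" "X y'" u v]
  by (intro transport_opposite_swap) (auto simp: fibre_iff)

section \<open>The fibres as torsors under Aut(I)\<close>

lemma torsor_fibre:
  assumes x: "x \<in> carrier (pi0 C)" and y: "y \<in> carrier (pi0 C)"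
  shows "right_torsor (Aut_unit C) (commutator_fibre C X x y) (commutator_act C X x y)"
proof -
  interpret A: comm_group "Aut_unit C"
    by (rule Aut_unit_comm_group)
  let ?YX = "X y \<odot> X x"
  have sel: "mult (Aut_unit C) = Comp C" "one (Aut_unit C) = Ident C (Tensor_unit C)"
    by (simp_all add: Aut_unit_def)
  have YX: "?YX \<in> Obj C"
    using x y by simp
  show ?thesis
  proof
    fix s t assume "s \<in> commutator_fibre C X x y" "t \<in> commutator_fibre C X x y"
    then have s: "swap_arrow C (X x) (X y) s" and t: "swap_arrow C (X x) (X y) t"
      by (simp_all add: fibre_iff)
    \<comment> \<open>The quotient of two swaps is an automorphism of
      \<open>X y \<odot> X x\<close>, hence a scalar; this is transitivity of the action.\<close>
    obtain a where a: "a \<in> carrier (Aut_unit C)" "right_mult C ?YX a = arr_inv C s \<bullet> t"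
      using right_mult_surj[of "arr_inv C s \<bullet> t" ?YX] s t by auto
    show "\<exists>!a. a \<in> carrier (Aut_unit C) \<and> commutator_act C X x y s a = t"
    proof (rule ex1I[of _ a])
      show "a \<in> carrier (Aut_unit C) \<and> commutator_act C X x y s a = t"
        using a s t by (simp add: commutator_act_def)
      fix b assume b: "b \<in> carrier (Aut_unit C) \<and> commutator_act C X x y s b = t"
      then have "s \<bullet> right_mult C ?YX b = s \<bullet> right_mult C ?YX a"
        using a s t by (simp add: commutator_act_def)
      then have "right_mult C ?YX b = right_mult C ?YX a"
        by (rule Comp_left_cancel) (use a(1) b s YX in simp_all)
      then show "b = a"
        by (rule right_mult_inj) (use a(1) b YX in simp_all)
    qed
  next
    \<comment> \<open>As the group of classes is abelian, \<open>c y x\<close> and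
      \<open>c x y\<close> have the same target, which yields a swap.\<close>
    have "arr_inv C (c x y) \<bullet> c y x \<in> commutator_fibre C X x y"
      using x y B.m_comm[OF x y] by (simp add: fibre_iff)
    then show "commutator_fibre C X x y \<noteq> {}"
      by auto
  qed (use x y in \<open>auto simp: commutator_act_def fibre_iff sel right_mult_Comp\<close>)
qed

lemma torsor_pair_fibre:
  assumes "x \<in> carrier (pi0 C)" "y \<in> carrier (pi0 C)" "x' \<in> carrier (pi0 C)" "y' \<in> carrier (pi0 C)"
  shows "torsor_pair (Aut_unit C) (commutator_fibre C X x y) (commutator_act C X x y)
    (commutator_fibre C X x' y') (commutator_act C X x' y')"
  using torsor_fibre assms Aut_unit_comm_group by (simp add: torsor_pair_def)

lemma act_closed:
  assumes "x \<in> carrier (pi0 C)" "y \<in> carrier (pi0 C)" "u \<in> commutator_fibre C X x y"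
    "a \<in> carrier (Aut_unit C)"
  shows "commutator_act C X x y u a \<in> commutator_fibre C X x y"
  using right_torsor.act_closed[OF torsor_fibre] assms by blast

section \<open>Equivariance, associativity and interchange of the two laws\<close>

lemma add1_act:
  assumes x: "x \<in> carrier (pi0 C)" "x' \<in> carrier (pi0 C)" "y \<in> carrier (pi0 C)"
    and u: "u \<in> commutator_fibre C X x y" and v: "v \<in> commutator_fibre C X x' y"
    and a: "a \<in> carrier (Aut_unit C)"
  shows "commutator_add1 C X c x x' y (commutator_act C X x y u a) v
      = commutator_act C X (x \<otimes>\<^bsub>pi0 C\<^esub> x') y (commutator_add1 C X c x x' y u v) a"
    "commutator_add1 C X c x x' y u (commutator_act C X x' y v a)
      = commutator_act C X (x \<otimes>\<^bsub>pi0 C\<^esub> x') y (commutator_add1 C X c x x' y u v) a"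
proof -
  note uv = half_braid_swap[of "X x" "X x'" "X y" u v]
  note scalars = half_braid_scalar[of a "X x" "X x'" "X y" u v]
    transport_scalar[of a "c x x'" "X x \<odot> X x'" "X (x \<otimes>\<^bsub>pi0 C\<^esub> x')" "X y" "half_braid C (X x) (X x') (X y) u v"]
  show "commutator_add1 C X c x x' y (commutator_act C X x y u a) v
      = commutator_act C X (x \<otimes>\<^bsub>pi0 C\<^esub> x') y (commutator_add1 C X c x x' y u v) a"
    unfolding act_eq[OF B.m_closed[OF x(1,2)] x(3) add1_closed[OF x u v] a]
      add1_eq[OF x act_closed[OF x(1,3) u a] v]
    unfolding add1_eq[OF x u v] act_eq[OF x(1,3) u a]
    using x u v a uv scalars by (simp add: fibre_iff)
  show "commutator_add1 C X c x x' y u (commutator_act C X x' y v a)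
      = commutator_act C X (x \<otimes>\<^bsub>pi0 C\<^esub> x') y (commutator_add1 C X c x x' y u v) a"
    unfolding act_eq[OF B.m_closed[OF x(1,2)] x(3) add1_closed[OF x u v] a]
      add1_eq[OF x u act_closed[OF x(2,3) v a]]
    unfolding add1_eq[OF x u v] act_eq[OF x(2,3) v a]
    using x u v a uv scalars by (simp add: fibre_iff)
qed

text \<open>A scalar at the target in the opposite category is one at the source in
  \<open>C\<close>, which is the form in \<open>commutator_act_def\<close>; so the definition of the
  action is unfolded directly.\<close>

lemma add2_act:
  assumes x: "x \<in> carrier (pi0 C)" "y \<in> carrier (pi0 C)" "y' \<in> carrier (pi0 C)"
    and u: "u \<in> commutator_fibre C X x y" and v: "v \<in> commutator_fibre C X x y'"
    and a: "a \<in> carrier (Aut_unit C)"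
  shows "commutator_add2 C X c x y y' (commutator_act C X x y u a) v
      = commutator_act C X x (y \<otimes>\<^bsub>pi0 C\<^esub> y') (commutator_add2 C X c x y y' u v) a"
    "commutator_add2 C X c x y y' u (commutator_act C X x y' v a)
      = commutator_act C X x (y \<otimes>\<^bsub>pi0 C\<^esub> y') (commutator_add2 C X c x y y' u v) a"
proof -
  interpret opc: central_gr_category "opposite C"
    by (rule opposite_central)
  note uv = half_braid_opposite_swap[of "X x" "X y" "X y'" u v]
  note scalars = opc.half_braid_scalar[of a "X y" "X y'" "X x" u v]
    op.transport_scalar[of a "arr_inv C (c y y')" "X y \<odot> X y'" "X (y \<otimes>\<^bsub>pi0 C\<^esub> y')" "X x"
      "half_braid (opposite C) (X y) (X y') (X x) u v"]
  show "commutator_add2 C X c x y y' (commutator_act C X x y u a) v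
      = commutator_act C X x (y \<otimes>\<^bsub>pi0 C\<^esub> y') (commutator_add2 C X c x y y' u v) a"
    unfolding add2_eq[OF x u v] add2_eq[OF x act_closed[OF x(1,2) u a] v]
    unfolding commutator_act_def
    using x u v a uv scalars by (simp add: fibre_iff)
  show "commutator_add2 C X c x y y' u (commutator_act C X x y' v a)
      = commutator_act C X x (y \<otimes>\<^bsub>pi0 C\<^esub> y') (commutator_add2 C X c x y y' u v) a"
    unfolding add2_eq[OF x u v] add2_eq[OF x u act_closed[OF x(1,3) v a]]
    unfolding commutator_act_def
    using x u v a uv scalars by (simp add: fibre_iff)
qed

text \<open>The four arrows of \<open>transport_half_braid_assoc\<close> are the values of
  \<open>c\<close> that occur, and the final targets agree by associativity in
  \<open>pi0 C\<close>.\<close>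

lemma add1_assoc:
  assumes x: "x \<in> carrier (pi0 C)" "x' \<in> carrier (pi0 C)" "x'' \<in> carrier (pi0 C)" "y \<in> carrier (pi0 C)"
    and u: "u \<in> commutator_fibre C X x y" and v: "v \<in> commutator_fibre C X x' y"
    and w: "w \<in> commutator_fibre C X x'' y"
  shows "commutator_add1 C X c (x \<otimes>\<^bsub>pi0 C\<^esub> x') x'' y (commutator_add1 C X c x x' y u v) w
    = commutator_add1 C X c x (x' \<otimes>\<^bsub>pi0 C\<^esub> x'') y u (commutator_add1 C X c x' x'' y v w)"
  using assms add1_closed[OF x(1,2,4) u v] add1_closed[OF x(2,3,4) v w]
  by (simp add: add1_eq)
    (rule transport_half_braid_assoc; simp add: fibre_iff B.m_assoc)

lemma add2_assoc:
  assumes x: "x \<in> carrier (pi0 C)" "y \<in> carrier (pi0 C)" "y' \<in> carrier (pi0 C)" "y'' \<in> carrier (pi0 C)"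
    and u: "u \<in> commutator_fibre C X x y" and v: "v \<in> commutator_fibre C X x y'"
    and w: "w \<in> commutator_fibre C X x y''"
  shows "commutator_add2 C X c x (y \<otimes>\<^bsub>pi0 C\<^esub> y') y'' (commutator_add2 C X c x y y' u v) w
    = commutator_add2 C X c x y (y' \<otimes>\<^bsub>pi0 C\<^esub> y'') u (commutator_add2 C X c x y' y'' v w)"
proof -
  interpret opc: central_gr_category "opposite C"
    by (rule opposite_central)
  show ?thesis
    using assms add2_closed[OF x(1,2,3) u v] add2_closed[OF x(1,3,4) v w]
    by (simp add: add2_eq)
      (rule opc.transport_half_braid_assoc; simp add: fibre_iff B.m_assoc)
qed

text \<open>Each side carries a transport along \<open>c x x'\<close> in the first variable and one
  along \<open>c y y'\<close> in the second. Pulled to the outside they commute, and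
  \<open>half_braid_interchange\<close> remains inside.\<close>

lemma add_interchange:
  assumes x: "x \<in> carrier (pi0 C)" "x' \<in> carrier (pi0 C)" and y: "y \<in> carrier (pi0 C)" "y' \<in> carrier (pi0 C)"
    and a: "a \<in> commutator_fibre C X x y" and b: "b \<in> commutator_fibre C X x' y"
    and c': "c' \<in> commutator_fibre C X x y'" and d: "d \<in> commutator_fibre C X x' y'"
  shows "commutator_add2 C X c (x \<otimes>\<^bsub>pi0 C\<^esub> x') y y'
      (commutator_add1 C X c x x' y a b) (commutator_add1 C X c x x' y' c' d)
    = commutator_add1 C X c x x' (y \<otimes>\<^bsub>pi0 C\<^esub> y')
      (commutator_add2 C X c x y y' a c') (commutator_add2 C X c x' y y' b d)"
    (is "?l = ?r")
proof -
  let ?P = "X x" and ?P' = "X x'" and ?Q = "X y" and ?Q' = "X y'"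
  let ?xx = "x \<otimes>\<^bsub>pi0 C\<^esub> x'" and ?yy = "y \<otimes>\<^bsub>pi0 C\<^esub> y'"
  let ?h = "c x x'" and ?k = "arr_inv C (c y y')"
  let ?ab = "half_braid C ?P ?P' ?Q a b" and ?cd = "half_braid C ?P ?P' ?Q' c' d"
  let ?ac = "half_braid (opposite C) ?Q ?Q' ?P a c'" and ?bd = "half_braid (opposite C) ?Q ?Q' ?P' b d"
  note fib = a[unfolded fibre_iff] b[unfolded fibre_iff] c'[unfolded fibre_iff] d[unfolded fibre_iff]
  note [simp] = x y
  have ab: "swap_arrow C (?P \<odot> ?P') ?Q ?ab" and cd: "swap_arrow C (?P \<odot> ?P') ?Q' ?cd"
    using fib by (simp_all add: half_braid_swap)
  have ac: "swap_arrow C ?P (?Q \<odot> ?Q') ?ac" and bd: "swap_arrow C ?P' (?Q \<odot> ?Q') ?bd"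
    using fib by (simp_all add: half_braid_opposite_swap)
  have abcd: "swap_arrow C (?P \<odot> ?P') (?Q \<odot> ?Q') (half_braid (opposite C) ?Q ?Q' (?P \<odot> ?P') ?ab ?cd)"
    using ab cd by (simp add: half_braid_opposite_swap)
  have Tac: "swap_arrow C ?P (X ?yy) (transport (opposite C) ?P ?k ?ac)"
    and Tbd: "swap_arrow C ?P' (X ?yy) (transport (opposite C) ?P' ?k ?bd)"
    using ac bd by (simp_all add: transport_opposite_swap)
  have "?l = transport (opposite C) (X ?xx) ?k (half_braid (opposite C) ?Q ?Q' (X ?xx)
      (transport C ?Q ?h ?ab) (transport C ?Q' ?h ?cd))"
    using add1_closed[OF x y(1) a b] add1_closed[OF x y(2) c' d] a b c' d by (simp add: add2_eq add1_eq)
  also have "\<dots> = transport (opposite C) (X ?xx) ?k (transport C (?Q \<odot> ?Q') ?h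
      (half_braid (opposite C) ?Q ?Q' (?P \<odot> ?P') ?ab ?cd))"
    using ab cd by (subst half_braid_opposite_transport[where P = "?P \<odot> ?P'"]) auto
  also have "\<dots> = transport C (X ?yy) ?h (transport (opposite C) (?P \<odot> ?P') ?k
      (half_braid (opposite C) ?Q ?Q' (?P \<odot> ?P') ?ab ?cd))"
    using abcd by (subst transport_opposite_commute[where P = "?P \<odot> ?P'" and S = "X ?yy"]) auto
  also have "\<dots> = transport C (X ?yy) ?h (transport (opposite C) (?P \<odot> ?P') ?k
      (half_braid C ?P ?P' (?Q \<odot> ?Q') ?ac ?bd))"
    using fib by (simp add: half_braid_interchange)
  \<comment> \<open>This is \<open>half_braid_opposite_transport\<close> read in the opposite
    category, where the product is formed in \<open>opposite (opposite C)\<close> and has to be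
    brought back to \<open>C\<close>.\<close>
  also have "transport (opposite C) (?P \<odot> ?P') ?k (half_braid C ?P ?P' (?Q \<odot> ?Q') ?ac ?bd)
      = half_braid C ?P ?P' (X ?yy) (transport (opposite C) ?P ?k ?ac) (transport (opposite C) ?P' ?k ?bd)"
    using ac bd Tac Tbd
      op.half_braid_opposite_transport[of "?Q \<odot> ?Q'" ?P ?P' ?k "X ?yy" ?ac ?bd]
    by (simp add: half_braid_opposite_opposite gr_category_axioms)
  also have "transport C (X ?yy) ?h \<dots> = ?r"
    using add2_closed[OF x(1) y a c'] add2_closed[OF x(2) y b d] a b c' d by (simp add: add2_eq add1_eq)
  finally show ?thesis .
qed

lemma weak_biextension:
  "weak_biextension (pi0 C) (Aut_unit C) (commutator_fibre C X) (commutator_act C X)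
    (commutator_add1 C X c) (commutator_add2 C X c)"
proof -
  interpret A: comm_group "Aut_unit C"
    by (rule Aut_unit_comm_group)
  show ?thesis
  proof (intro weak_biextension.intro weak_biextension_axioms.intro
      B.comm_group_axioms A.comm_group_axioms)
    fix x x' y assume "x \<in> carrier (pi0 C)" "x' \<in> carrier (pi0 C)" "y \<in> carrier (pi0 C)"
    then show "induces_torsor_morphism (Aut_unit C) (commutator_fibre C X x y) (commutator_act C X x y)
        (commutator_fibre C X x' y) (commutator_act C X x' y)
        (commutator_fibre C X (x \<otimes>\<^bsub>pi0 C\<^esub> x') y) (commutator_act C X (x \<otimes>\<^bsub>pi0 C\<^esub> x') y)
        (commutator_add1 C X c x x' y)"
      by (intro torsor_pair.induces_torsor_morphismI torsor_pair_fibre torsor_fibre add1_closed add1_act)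
        auto
  next
    fix x y y' assume "x \<in> carrier (pi0 C)" "y \<in> carrier (pi0 C)" "y' \<in> carrier (pi0 C)"
    then show "induces_torsor_morphism (Aut_unit C) (commutator_fibre C X x y) (commutator_act C X x y)
        (commutator_fibre C X x y') (commutator_act C X x y')
        (commutator_fibre C X x (y \<otimes>\<^bsub>pi0 C\<^esub> y')) (commutator_act C X x (y \<otimes>\<^bsub>pi0 C\<^esub> y'))
        (commutator_add2 C X c x y y')"
      by (intro torsor_pair.induces_torsor_morphismI torsor_pair_fibre torsor_fibre add2_closed add2_act)
        auto
  qed (simp_all add: torsor_fibre add1_assoc add2_assoc add_interchange)
qed

end

theorem proposition3p1:
  fixes C :: "('o, 'm, 'z) moncat_scheme"
    and X :: "'o set \<Rightarrow> 'o"
    and c :: "'o set \<Rightarrow> 'o set \<Rightarrow> 'm"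
  assumes "gr_category C"
    and "comm_group (pi0 C)"
    and "\<And>x a. \<lbrakk>x \<in> carrier (pi0 C); a \<in> carrier (Aut_unit C)\<rbrakk> \<Longrightarrow> pi0_action C x a = a"
    and "\<And>x. x \<in> carrier (pi0 C) \<Longrightarrow> X x \<in> x"
    and "\<And>x y. \<lbrakk>x \<in> carrier (pi0 C); y \<in> carrier (pi0 C)\<rbrakk>
      \<Longrightarrow> c x y \<in> homset C (X x \<odot>\<^bsub>C\<^esub> X y) (X (x \<otimes>\<^bsub>pi0 C\<^esub> y))"
  shows "weak_biextension (pi0 C) (Aut_unit C) (commutator_fibre C X) (commutator_act C X)
    (commutator_add1 C X c) (commutator_add2 C X c)"
proof -
  interpret C: gr_category C
    by (rule assms(1))
  interpret B: comm_group "pi0 C"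
    by (rule assms(2))
  interpret gr_commutator C X c
  proof
    fix Y a assume Y: "Y \<in> Obj C" and a: "a \<in> carrier (Aut_unit C)"
    \<comment> \<open>Every object lies over some class, so the hypothesis on classes yields the
      equation at all objects and not just at the chosen ones.\<close>
    then have "pi0_action C (iso_class C Y) a = a"
      by (intro assms(3)) (auto simp: pi0_def)
    then show "left_mult C Y a = right_mult C Y a"
      using C.left_mult_eq_right_mult_pi0_action[OF Y a] by simp
  qed (use assms(4,5) in auto)
  show ?thesis
    by (rule weak_biextension)
qed

end
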